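(* Let $\Pi$ be a rectagraph with $a_2(\Pi)=0$ and $c_3(\Pi)=3$, and let $n$ be a positive integer. There exists $u\in V\Pi$ such that the action of $\mathrm{Aut}(\Pi)_u$ on $\Pi(u)$ is permutation isomorphic to the natural action of $S_n$ or $A_n$ on $[n]=\{1,\dots,n\}$ if and only if $\Pi$ is (isomorphic to) the $n$-cube $Q_n$, or $n\geq 7$ and $\Pi$ is (isomorphic to) the folded $n$-cube $\Box_n$.
   Context: All graphs are finite, simple and undirected. A rectagraph is a connected triangle-free graph in which every $2$-arc (triple $(u,v,w)$ with $u\ne w$, $u,w\in\Pi(v)$) lies in a unique quadrangle. $\Pi_i(u)$ is the set of vertices at distance $i$ from $u$, $\Pi(u)=\Pi_1(u)$. For $u,v$ at distance $i$, $c_i(u,v)=|\Pi_{i-1}(u)\cap\Pi(v)|$ and $a_i(u,v)=|\Pi_i(u)\cap\Pi(v)|$; $c_i(\Pi)=c$ (resp. $a_i(\Pi)=a$) means $c_i(u,v)=c$ (resp. $a_i(u,v)=a$) for all $u,v$ at distance $i$ (vacuously true if there are none). Actions of $G$ on $\Omega$ and $H$ on $\Delta$ are permutation isomorphic if the action of $G$ or $H$ is faithful and there are a group isomorphism $\psi:G\to H$ and a bijection $\varphi:\Omega\to\Delta$ with $(\omega^g)\varphi=(\omega\varphi)^{g\psi}$ for all $\omega\in\Omega$, $g\in G$. $Q_n$ has vertex set $\mathbb{F}_2^n$, vectors adjacent when they differ in exactly one coordinate. $\Box_n$ has as vertices the cosets of $\{0,(1,\dots,1)\}$ in $\mathbb{F}_2^n$,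 two being adjacent when they contain elements adjacent in $Q_n$. *)

theory Defs
  imports
    "Graph_Theory.Pair_Digraph"
    "Graph_Theory.Shortest_Path"
    "Graph_Theory.Digraph_Isomorphism"
    "HOL-Algebra.Sym_Groups"
    "HOL-Algebra.Group_Action"
    "HOL-Algebra.Elementary_Groups"
    "HOL-Algebra.Product_Groups"
begin

text \<open>
  A finite simple undirected graph is a \<open>pair_graph\<close>: a finite vertex set with a symmetric,
  irreflexive adjacency relation \<open>parcs\<close>.  Each undirected edge is thus a pair of opposite arcs.
\<close>

section \<open>Neighbourhoods, distance and intersection numbers\<close>

definition nbhd :: "'a pair_pre_digraph \<Rightarrow> 'a \<Rightarrow> 'a set" where
  "nbhd \<Gamma> u = {v \<in> pverts \<Gamma>. (u, v) \<in> parcs \<Gamma>}"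

text \<open>With unit arc costs, \<open>\<mu>\<close> is the length of a shortest walk (infinite if there is none).\<close>

definition sphere :: "'a pair_pre_digraph \<Rightarrow> nat \<Rightarrow> 'a \<Rightarrow> 'a set" where
  "sphere \<Gamma> i u =
     {v \<in> pverts \<Gamma>. wf_digraph.\<mu> (with_proj \<Gamma>) (\<lambda>_. 1) u v = ereal (real i)}"

text \<open>\<open>c_const \<Gamma> i c\<close> and \<open>a_const \<Gamma> i a\<close> stand for $c_i(\Gamma)=c$ and $a_i(\Gamma)=a$; the former is
  meant for \<open>i \<ge> 1\<close> only, because of truncated subtraction.\<close>

definition c_const :: "'a pair_pre_digraph \<Rightarrow> nat \<Rightarrow> nat \<Rightarrow> bool" where
  "c_const \<Gamma> i c \<longleftrightarrow>
     (\<forall>u\<in>pverts \<Gamma>. \<forall>v\<in>sphere \<Gamma> i u. card (sphere \<Gamma> (i - 1) u \<inter> nbhd \<Gamma> v) = c)"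

definition a_const :: "'a pair_pre_digraph \<Rightarrow> nat \<Rightarrow> nat \<Rightarrow> bool" where
  "a_const \<Gamma> i a \<longleftrightarrow>
     (\<forall>u\<in>pverts \<Gamma>. \<forall>v\<in>sphere \<Gamma> i u. card (sphere \<Gamma> i u \<inter> nbhd \<Gamma> v) = a)"

section \<open>Rectagraphs\<close>

text \<open>A quadrangle is a 4-cycle, given by its set of (undirected) edges.\<close>

definition quadrangle :: "'a pair_pre_digraph \<Rightarrow> 'a set set \<Rightarrow> bool" where
  "quadrangle \<Gamma> Q \<longleftrightarrow>
     (\<exists>a b c d. distinct [a, b, c, d] \<and>
        (a, b) \<in> parcs \<Gamma> \<and> (b, c) \<in> parcs \<Gamma> \<and> (c, d) \<in> parcs \<Gamma> \<and> (d, a) \<in> parcs \<Gamma> \<and>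
        Q = {{a, b}, {b, c}, {c, d}, {d, a}})"

locale rectagraph = pair_graph \<Gamma> for \<Gamma> :: "'a pair_pre_digraph" +
  assumes connected: "Digraph_Component.connected (with_proj \<Gamma>)"
    and triangle_free: "\<not> (\<exists>u v w. (u, v) \<in> parcs \<Gamma> \<and> (v, w) \<in> parcs \<Gamma> \<and> (w, u) \<in> parcs \<Gamma>)"
    and unique_quadrangle:
      "\<lbrakk>v \<in> pverts \<Gamma>; u \<in> nbhd \<Gamma> v; w \<in> nbhd \<Gamma> v; u \<noteq> w\<rbrakk> \<Longrightarrow>
         \<exists>!Q. quadrangle \<Gamma> Q \<and> {u, v} \<in> Q \<and> {v, w} \<in> Q"

section \<open>Automorphisms and permutation isomorphism\<close>

text \<open>Following \<open>BijGroup\<close>, automorphisms are made extensional (undefined off the vertex set), so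
  that an automorphism is determined by its values on the vertices.\<close>

definition aut_group :: "'a pair_pre_digraph \<Rightarrow> ('a \<Rightarrow> 'a) monoid" where
  "aut_group \<Gamma> = (BijGroup (pverts \<Gamma>))
     \<lparr>carrier := {f \<in> Bij (pverts \<Gamma>).
        \<forall>x\<in>pverts \<Gamma>. \<forall>y\<in>pverts \<Gamma>. (f x, f y) \<in> parcs \<Gamma> \<longleftrightarrow> (x, y) \<in> parcs \<Gamma>}\<rparr>"

definition vertex_stabilizer :: "'a pair_pre_digraph \<Rightarrow> 'a \<Rightarrow> ('a \<Rightarrow> 'a) monoid" where
  "vertex_stabilizer \<Gamma> u =
     (aut_group \<Gamma>)\<lparr>carrier := stabilizer (aut_group \<Gamma>) (\<lambda>g. g) u\<rparr>"

text \<open>The natural action of a group of functions on an invariant set \<open>X\<close>.\<close>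

definition natural_action :: "'a set \<Rightarrow> ('a \<Rightarrow> 'a) \<Rightarrow> 'a \<Rightarrow> 'a" where
  "natural_action X g = restrict g X"

definition perm_isomorphic ::
  "('g, 'x) monoid_scheme \<Rightarrow> 'a set \<Rightarrow> ('g \<Rightarrow> 'a \<Rightarrow> 'a) \<Rightarrow>
   ('h, 'y) monoid_scheme \<Rightarrow> 'b set \<Rightarrow> ('h \<Rightarrow> 'b \<Rightarrow> 'b) \<Rightarrow> bool" where
  "perm_isomorphic G \<Omega> \<alpha> H \<Delta> \<beta> \<longleftrightarrow>
     group_action G \<Omega> \<alpha> \<and> group_action H \<Delta> \<beta> \<and>
     (faithful_action G \<Omega> \<alpha> \<or> faithful_action H \<Delta> \<beta>) \<and>
     (\<exists>\<psi>\<in>iso G H. \<exists>\<phi>. bij_betw \<phi> \<Omega> \<Delta> \<and>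
        (\<forall>g\<in>carrier G. \<forall>\<omega>\<in>\<Omega>. \<phi> (\<alpha> g \<omega>) = \<beta> (\<psi> g) (\<phi> \<omega>)))"

section \<open>Cubes and folded cubes\<close>

text \<open>The additive group of $\mathbb{F}_2^n$; vectors are extensional functions from \<open>{1..n}\<close> to
  \<open>{0, 1}\<close>.\<close>

definition F2_vectors :: "nat \<Rightarrow> (nat \<Rightarrow> int) monoid" where
  "F2_vectors n = product_group {1..n} (\<lambda>_. integer_mod_group 2)"

definition cube :: "nat \<Rightarrow> (nat \<Rightarrow> int) pair_pre_digraph" where
  "cube n = \<lparr>pverts = carrier (F2_vectors n),
     parcs = {(x, y). x \<in> carrier (F2_vectors n) \<and> y \<in> carrier (F2_vectors n) \<and>
                card {i \<in> {1..n}. x i \<noteq> y i} = 1}\<rparr>"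

definition repetition_code :: "nat \<Rightarrow> (nat \<Rightarrow> int) set" where
  "repetition_code n = {(\<lambda>i\<in>{1..n}. 0), (\<lambda>i\<in>{1..n}. 1)}"

text \<open>The condition \<open>A \<noteq> B\<close> only matters for \<open>n = 1\<close>, where it prevents a loop.\<close>

definition folded_cube :: "nat \<Rightarrow> (nat \<Rightarrow> int) set pair_pre_digraph" where
  "folded_cube n = \<lparr>pverts = rcosets\<^bsub>F2_vectors n\<^esub> (repetition_code n),
     parcs = {(A, B). A \<in> rcosets\<^bsub>F2_vectors n\<^esub> (repetition_code n) \<and>
                B \<in> rcosets\<^bsub>F2_vectors n\<^esub> (repetition_code n) \<and> A \<noteq> B \<and>
                (\<exists>x\<in>A. \<exists>y\<in>B. (x, y) \<in> parcs (cube n))}\<rparr>"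

section \<open>The notions above are well formed\<close>

lemma (in pair_graph) awalk_iff_relpow:
  assumes "u \<in> pverts G"
  shows "(\<exists>p. awalk u p v \<and> length p = k) \<longleftrightarrow> (u, v) \<in> parcs G ^^ k"
  using assms
proof (induction k arbitrary: u)
  case 0
  then show ?case by (auto simp: awalk_Nil_iff)
next
  case (Suc k)
  have "(\<exists>p. awalk u p v \<and> length p = Suc k) \<longleftrightarrow>
      (\<exists>w. (u, w) \<in> parcs G \<and> (\<exists>p. awalk w p v \<and> length p = k))"
  proof
    assume "\<exists>p. awalk u p v \<and> length p = Suc k"
    then obtain e p where "awalk u (e # p) v" "length p = k"
      by (metis length_Suc_conv)
    then show "\<exists>w. (u, w) \<in> parcs G \<and> (\<exists>p. awalk w p v \<and> length p = k)"
      by (cases e) (auto simp: awalk_Cons_iff)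
  next
    assume "\<exists>w. (u, w) \<in> parcs G \<and> (\<exists>p. awalk w p v \<and> length p = k)"
    then obtain w p where "(u, w) \<in> parcs G" "awalk w p v" "length p = k" by blast
    then have "awalk u ((u, w) # p) v \<and> length ((u, w) # p) = Suc k"
      by (simp add: awalk_Cons_iff)
    then show "\<exists>p. awalk u p v \<and> length p = Suc k" by blast
  qed
  also have "\<dots> \<longleftrightarrow> (\<exists>w. (u, w) \<in> parcs G \<and> (w, v) \<in> parcs G ^^ k)"
    using Suc.IH in_arcsD2 by blast
  also have "\<dots> \<longleftrightarrow> (u, v) \<in> parcs G ^^ Suc k"
    by (meson relpow_Suc_D2 relpow_Suc_I2)
  finally show ?case .
qed

lemma (in pair_graph) mu_eq_iff:
  assumes "u \<in> pverts G"
  shows "\<mu> (\<lambda>_. 1) u v = ereal (real i) \<longleftrightarrow>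
    (u, v) \<in> parcs G ^^ i \<and> (\<forall>j<i. (u, v) \<notin> parcs G ^^ j)"
proof -
  have cost: "awalk_cost (\<lambda>_. 1) p = real (length p)" for p :: "('a \<times> 'a) list"
    by (induction p) auto
  let ?P = "\<lambda>k. (u, v) \<in> parcs G ^^ k"
  have mu: "\<mu> (\<lambda>_. 1) u v = (INF k \<in> Collect ?P. ereal (real k))"
  proof -
    have "(\<lambda>p. ereal (awalk_cost (\<lambda>_. 1) p)) ` {p. awalk u p v} = (\<lambda>k. ereal (real k)) ` Collect ?P"
      unfolding cost awalk_iff_relpow[OF assms, symmetric] by auto
    then show ?thesis unfolding \<mu>_def by simp
  qed
  have least: "\<mu> (\<lambda>_. 1) u v = ereal (real k)" if "?P k" "\<forall>j<k. \<not> ?P j" for k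
    unfolding mu
  proof (rule antisym)
    show "(INF k \<in> Collect ?P. ereal (real k)) \<le> ereal (real k)"
      using that by (intro INF_lower) simp
    show "ereal (real k) \<le> (INF k \<in> Collect ?P. ereal (real k))"
      using that by (intro INF_greatest) (auto simp: not_less[symmetric])
  qed
  show ?thesis
  proof
    assume *: "\<mu> (\<lambda>_. 1) u v = ereal (real i)"
    have "Collect ?P \<noteq> {}"
    proof
      assume "Collect ?P = {}"
      then have "\<mu> (\<lambda>_. 1) u v = \<infinity>" unfolding mu by (simp only:) (simp add: top_ereal_def)
      with * show False by simp
    qed
    then have "\<exists>k. ?P k" by blast
    then obtain k where k: "?P k" "\<forall>j<k. \<not> ?P j" using exists_least_iff[of ?P] by blast
    with least[OF k] * show "?P i \<and> (\<forall>j<i. \<not> ?P j)" by simp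
  next
    assume "?P i \<and> (\<forall>j<i. \<not> ?P j)"
    then show "\<mu> (\<lambda>_. 1) u v = ereal (real i)" using least by blast
  qed
qed

lemma (in pair_graph) sphere_eq:
  assumes "u \<in> pverts G"
  shows "sphere G i u = {v. (u, v) \<in> parcs G ^^ i \<and> (\<forall>j<i. (u, v) \<notin> parcs G ^^ j)}"
proof -
  have "v \<in> pverts G" if "(u, v) \<in> parcs G ^^ i" for v
    using that assms by (cases i) (auto dest: in_arcsD2)
  then show ?thesis unfolding sphere_def mu_eq_iff[OF assms] by auto
qed

lemma (in pair_graph) nbhd_eq_sphere:
  assumes "u \<in> pverts G"
  shows "nbhd G u = sphere G 1 u"
proof -
  have "(u, u) \<notin> parcs G" using pair_no_loops[of "(u, u)"] by auto
  then have "v \<in> nbhd G u \<longleftrightarrow> v \<in> sphere G 1 u" for v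
    unfolding sphere_eq[OF assms] nbhd_def using in_arcsD2[of u v] by (cases "v = u") auto
  then show ?thesis by blast
qed

lemma subgroup_aut_group: "subgroup (carrier (aut_group \<Gamma>)) (BijGroup (pverts \<Gamma>))"
proof -
  interpret B: group "BijGroup (pverts \<Gamma>)" by (rule group_BijGroup)
  let ?V = "pverts \<Gamma>"
  show ?thesis
  proof (rule B.subgroupI)
    show "carrier (aut_group \<Gamma>) \<subseteq> carrier (BijGroup ?V)"
      by (auto simp: aut_group_def BijGroup_def)
    have "restrict (\<lambda>x. x) ?V \<in> carrier (aut_group \<Gamma>)"
      by (simp add: aut_group_def id_Bij)
    then show "carrier (aut_group \<Gamma>) \<noteq> {}" by blast
  next
    fix f assume f: "f \<in> carrier (aut_group \<Gamma>)"
    then have b: "f \<in> Bij ?V" "bij_betw f ?V ?V" by (auto simp: aut_group_def Bij_def)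
    have inv: "inv\<^bsub>BijGroup ?V\<^esub> f = restrict (inv_into ?V f) ?V"
      using b(1) by (rule inv_BijGroup)
    have "(inv_into ?V f x, inv_into ?V f y) \<in> parcs \<Gamma> \<longleftrightarrow> (x, y) \<in> parcs \<Gamma>"
      if "x \<in> ?V" "y \<in> ?V" for x y
    proof -
      have "inv_into ?V f x \<in> ?V" "inv_into ?V f y \<in> ?V"
        using b that by (auto intro: Bij_inv_into_mem)
      then have "(f (inv_into ?V f x), f (inv_into ?V f y)) \<in> parcs \<Gamma>
          \<longleftrightarrow> (inv_into ?V f x, inv_into ?V f y) \<in> parcs \<Gamma>"
        using f by (simp add: aut_group_def)
      then show ?thesis using that b(2) by (simp add: bij_betw_inv_into_right)
    qed
    then show "inv\<^bsub>BijGroup ?V\<^esub> f \<in> carrier (aut_group \<Gamma>)"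
      unfolding inv using b(1) by (simp add: aut_group_def restrict_inv_into_Bij)
  next
    fix f g assume fg: "f \<in> carrier (aut_group \<Gamma>)" "g \<in> carrier (aut_group \<Gamma>)"
    then have "f \<in> Bij ?V" "g \<in> Bij ?V" by (auto simp: aut_group_def)
    moreover from this have "g x \<in> ?V" if "x \<in> ?V" for x
      using that Bij_imp_funcset by blast
    ultimately show "f \<otimes>\<^bsub>BijGroup ?V\<^esub> g \<in> carrier (aut_group \<Gamma>)"
      using fg by (auto simp: aut_group_def BijGroup_def compose_Bij compose_eq)
  qed
qed

lemma group_aut_group: "group (aut_group \<Gamma>)"
  using subgroup.subgroup_is_group[OF subgroup_aut_group group_BijGroup, of \<Gamma>]
  by (simp add: aut_group_def)

lemma group_action_aut_group: "group_action (aut_group \<Gamma>) (pverts \<Gamma>) (\<lambda>g. g)"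
proof -
  have "(\<lambda>g. g) \<in> hom (aut_group \<Gamma>) (BijGroup (pverts \<Gamma>))"
    by (auto simp: hom_def aut_group_def BijGroup_def)
  then show ?thesis
    by (simp add: group_action_def group_hom_def group_hom_axioms_def group_aut_group
        group_BijGroup)
qed

lemma group_vertex_stabilizer:
  assumes "u \<in> pverts \<Gamma>"
  shows "group (vertex_stabilizer \<Gamma> u)"
  unfolding vertex_stabilizer_def
  by (rule subgroup.subgroup_is_group[OF
        group_action.stabilizer_subgroup[OF group_action_aut_group assms] group_aut_group])

lemma group_action_natural_action:
  assumes "group G"
    and bij: "\<And>g. g \<in> carrier G \<Longrightarrow> bij_betw g X X"
    and mult: "\<And>g h x. \<lbrakk>g \<in> carrier G; h \<in> carrier G; x \<in> X\<rbrakk> \<Longrightarrow> (g \<otimes>\<^bsub>G\<^esub> h) x = g (h x)"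
  shows "group_action G X (natural_action X)"
proof -
  have B: "natural_action X g \<in> Bij X" if "g \<in> carrier G" for g
    using bij[OF that] by (auto simp: natural_action_def Bij_def cong: bij_betw_cong)
  have "h x \<in> X" if "h \<in> carrier G" "x \<in> X" for h x
    using bij[OF that(1)] that(2) by (auto simp: bij_betw_def)
  then have "natural_action X \<in> hom G (BijGroup X)"
    using B mult group.is_monoid[OF assms(1)]
    by (auto simp: hom_def BijGroup_def compose_def natural_action_def restrict_def fun_eq_iff)
  then show ?thesis
    using assms(1) by (simp add: group_action_def group_hom_def group_hom_axioms_def group_BijGroup)
qed

lemma group_action_vertex_stabilizer:
  assumes "u \<in> pverts \<Gamma>"
  shows "group_action (vertex_stabilizer \<Gamma> u) (nbhd \<Gamma> u) (natural_action (nbhd \<Gamma> u))"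
proof (rule group_action_natural_action)
  show "group (vertex_stabilizer \<Gamma> u)" using assms by (rule group_vertex_stabilizer)
next
  fix g assume "g \<in> carrier (vertex_stabilizer \<Gamma> u)"
  then have b: "bij_betw g (pverts \<Gamma>) (pverts \<Gamma>)" and u: "g u = u"
    and a: "\<And>x y. \<lbrakk>x \<in> pverts \<Gamma>; y \<in> pverts \<Gamma>\<rbrakk> \<Longrightarrow> (g x, g y) \<in> parcs \<Gamma> \<longleftrightarrow> (x, y) \<in> parcs \<Gamma>"
    by (auto simp: vertex_stabilizer_def stabilizer_def aut_group_def Bij_def)
  have adj: "(u, g y) \<in> parcs \<Gamma> \<longleftrightarrow> (u, y) \<in> parcs \<Gamma>" if "y \<in> pverts \<Gamma>" for y
    using a[OF assms that] u by simp
  have "g ` nbhd \<Gamma> u = nbhd \<Gamma> u"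
  proof
    show "g ` nbhd \<Gamma> u \<subseteq> nbhd \<Gamma> u"
      using b adj by (auto simp: nbhd_def bij_betw_def)
    show "nbhd \<Gamma> u \<subseteq> g ` nbhd \<Gamma> u"
    proof
      fix z assume z: "z \<in> nbhd \<Gamma> u"
      then obtain y where "y \<in> pverts \<Gamma>" "z = g y"
        using b by (auto simp: nbhd_def bij_betw_def)
      then show "z \<in> g ` nbhd \<Gamma> u" using z adj by (auto simp: nbhd_def)
    qed
  qed
  moreover have "inj_on g (nbhd \<Gamma> u)"
    using b by (auto simp: nbhd_def bij_betw_def intro: inj_on_subset)
  ultimately show "bij_betw g (nbhd \<Gamma> u) (nbhd \<Gamma> u)" by (simp add: bij_betw_def)
next
  fix g h x
  assume "g \<in> carrier (vertex_stabilizer \<Gamma> u)" "h \<in> carrier (vertex_stabilizer \<Gamma> u)"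
    "x \<in> nbhd \<Gamma> u"
  then show "(g \<otimes>\<^bsub>vertex_stabilizer \<Gamma> u\<^esub> h) x = g (h x)"
    by (auto simp: vertex_stabilizer_def stabilizer_def aut_group_def BijGroup_def compose_eq
        nbhd_def)
qed

lemma inj_on_natural_action_permutes: "inj_on (natural_action X) {p. p permutes X}"
proof (rule inj_onI)
  fix p q assume "p \<in> {p. p permutes X}" "q \<in> {p. p permutes X}"
    and eq: "natural_action X p = natural_action X q"
  then have pq: "p permutes X" "q permutes X" by auto
  show "p = q"
  proof
    fix x show "p x = q x"
      using fun_cong[OF eq, of x] pq by (cases "x \<in> X") (auto simp: natural_action_def permutes_def)
  qed
qed

lemma faithful_action_sym_group:
  "faithful_action (sym_group n) {1..n} (natural_action {1..n})"
  unfolding faithful_action_def faithful_action_axioms_def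
proof
  show "group_action (sym_group n) {1..n} (natural_action {1..n})"
    by (rule group_action_natural_action[OF sym_group_is_group])
      (auto simp: sym_group_def permutes_imp_bij)
  show "inj_on (natural_action {1..n}) (carrier (sym_group n))"
    using inj_on_natural_action_permutes by (simp add: sym_group_def)
qed

lemma faithful_action_alt_group:
  "faithful_action (alt_group n) {1..n} (natural_action {1..n})"
  unfolding faithful_action_def faithful_action_axioms_def
proof
  show "group_action (alt_group n) {1..n} (natural_action {1..n})"
    by (rule group_action_natural_action[OF alt_group_is_group])
      (auto simp: alt_group_def sym_group_def permutes_imp_bij)
  show "inj_on (natural_action {1..n}) (carrier (alt_group n))"
    using inj_on_natural_action_permutes
    by (rule inj_on_subset) (auto simp: alt_group_def)
qed

lemma group_F2_vectors: "group (F2_vectors n)"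
  by (simp add: F2_vectors_def)

lemma carrier_F2_vectors: "carrier (F2_vectors n) = {1..n} \<rightarrow>\<^sub>E {0, 1}"
proof -
  have "{0..<2::int} = {0, 1}" by auto
  then show ?thesis by (simp add: F2_vectors_def carrier_integer_mod_group)
qed

lemma subgroup_repetition_code: "subgroup (repetition_code n) (F2_vectors n)"
proof -
  interpret group "F2_vectors n" by (rule group_F2_vectors)
  have m: "x \<otimes>\<^bsub>F2_vectors n\<^esub> y = (\<lambda>i\<in>{1..n}. (x i + y i) mod 2)" for x y
    by (simp add: F2_vectors_def product_group_def)
  have o: "\<one>\<^bsub>F2_vectors n\<^esub> = (\<lambda>i\<in>{1..n}. 0)"
    by (simp add: F2_vectors_def product_group_def)
  have sub: "repetition_code n \<subseteq> carrier (F2_vectors n)"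
    by (auto simp: repetition_code_def carrier_F2_vectors)
  have self: "x \<otimes>\<^bsub>F2_vectors n\<^esub> x = \<one>\<^bsub>F2_vectors n\<^esub>" if "x \<in> repetition_code n" for x
    using that by (auto simp: m o repetition_code_def)
  show ?thesis
  proof (rule subgroupI[OF sub])
    show "repetition_code n \<noteq> {}" by (simp add: repetition_code_def)
    show "inv\<^bsub>F2_vectors n\<^esub> x \<in> repetition_code n" if "x \<in> repetition_code n" for x
      using inv_equality[OF self[OF that]] that sub by auto
    show "x \<otimes>\<^bsub>F2_vectors n\<^esub> y \<in> repetition_code n"
      if "x \<in> repetition_code n" "y \<in> repetition_code n" for x y
      using that by (auto simp: m repetition_code_def)
  qed
qed

lemma pair_graphI:
  assumes "finite (pverts G)" "parcs G \<subseteq> pverts G \<times> pverts G" "sym (parcs G)" "irrefl (parcs G)"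
  shows "pair_graph G"
proof -
  have "finite (parcs G)"
    using assms(1,2) finite_subset by blast
  then show ?thesis
    using assms by unfold_locales (auto simp: symmetric_def irrefl_def)
qed

lemma finite_F2_vectors: "finite (carrier (F2_vectors n))"
  unfolding carrier_F2_vectors by (intro finite_PiE) auto

lemma sym_parcs_cube: "sym (parcs (cube n))"
proof (rule symI)
  fix x y assume "(x, y) \<in> parcs (cube n)"
  moreover have "{i \<in> {1..n}. y i \<noteq> x i} = {i \<in> {1..n}. x i \<noteq> y i}" by (rule Collect_cong) metis
  ultimately show "(y, x) \<in> parcs (cube n)" by (simp only: cube_def) simp
qed

lemma pair_graph_cube: "pair_graph (cube n)"
  by (rule pair_graphI[OF _ _ sym_parcs_cube])
    (auto simp: cube_def finite_F2_vectors irrefl_def)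

lemma pair_graph_folded_cube: "pair_graph (folded_cube n)"
proof (rule pair_graphI)
  have "rcosets\<^bsub>F2_vectors n\<^esub> (repetition_code n) \<subseteq> Pow (carrier (F2_vectors n))"
    using group.rcosets_part_G[OF group_F2_vectors subgroup_repetition_code, of n] by blast
  then show "finite (pverts (folded_cube n))"
    using finite_F2_vectors by (auto simp: folded_cube_def intro: finite_subset)
  show "sym (parcs (folded_cube n))"
  proof (rule symI)
    fix A B assume "(A, B) \<in> parcs (folded_cube n)"
    then obtain x y where "x \<in> A" "y \<in> B" "(x, y) \<in> parcs (cube n)" "A \<noteq> B"
      "A \<in> rcosets\<^bsub>F2_vectors n\<^esub> (repetition_code n)"
      "B \<in> rcosets\<^bsub>F2_vectors n\<^esub> (repetition_code n)"
      unfolding folded_cube_def by auto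
    moreover from this have "(y, x) \<in> parcs (cube n)"
      using sym_parcs_cube by (blast dest: symD)
    ultimately show "(B, A) \<in> parcs (folded_cube n)"
      unfolding folded_cube_def by auto
  qed
qed (auto simp: folded_cube_def irrefl_def)

lemma digraph_iso_iff:
  fixes G :: "'a pair_pre_digraph" and H :: "'b pair_pre_digraph"
  assumes "pair_graph G" "pair_graph H"
  shows "digraph_iso (with_proj G) (with_proj H) \<longleftrightarrow>
    (\<exists>f. bij_betw f (pverts G) (pverts H) \<and>
       (\<forall>x\<in>pverts G. \<forall>y\<in>pverts G. (f x, f y) \<in> parcs H \<longleftrightarrow> (x, y) \<in> parcs G))"
    (is "?L \<longleftrightarrow> ?R")
proof -
  interpret G: pair_graph G by fact
  interpret H: pair_graph H by fact
  show ?thesis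
  proof
    assume ?L
    then obtain h where h: "G.digraph_isomorphism h" and eq: "with_proj H = app_iso h (with_proj G)"
      by (auto simp: digraph_iso_def)
    have t: "iso_tail h = fst" and hd: "iso_head h = snd"
      and V: "pverts H = iso_verts h ` pverts G" and E: "parcs H = iso_arcs h ` parcs G"
      using eq by (auto simp: with_proj_def app_iso_def)
    let ?f = "iso_verts h"
    have arc: "iso_arcs h (x, y) = (?f x, ?f y)" if "(x, y) \<in> parcs G" for x y
      using h that by (auto simp: G.digraph_isomorphism_def t hd prod_eq_iff)
    have inj: "inj_on ?f (pverts G)" using h by (simp add: G.digraph_isomorphism_def)
    have "(?f x, ?f y) \<in> parcs H \<longleftrightarrow> (x, y) \<in> parcs G" if xy: "x \<in> pverts G" "y \<in> pverts G" for x y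
    proof
      assume "(?f x, ?f y) \<in> parcs H"
      then obtain a b where ab: "(a, b) \<in> parcs G" "(?f x, ?f y) = iso_arcs h (a, b)"
        unfolding E by auto
      then have "?f x = ?f a" "?f y = ?f b" by (auto simp: arc)
      then have "x = a" "y = b"
        using inj xy ab(1) G.in_arcsD1 G.in_arcsD2 by (auto dest: inj_onD)
      then show "(x, y) \<in> parcs G" using ab by simp
    next
      assume "(x, y) \<in> parcs G"
      then show "(?f x, ?f y) \<in> parcs H" unfolding E by (metis arc image_eqI)
    qed
    then show ?R using inj V by (intro exI[of _ ?f]) (auto simp: bij_betw_def)
  next
    assume ?R
    then obtain f where inj: "inj_on f (pverts G)" and V: "pverts H = f ` pverts G"
      and a: "\<And>x y. \<lbrakk>x \<in> pverts G; y \<in> pverts G\<rbrakk> \<Longrightarrow> (f x, f y) \<in> parcs H \<longleftrightarrow> (x, y) \<in> parcs G"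
      by (auto simp: bij_betw_def)
    define h where "h = \<lparr>iso_verts = f, iso_arcs = map_prod f f, iso_head = snd, iso_tail = fst\<rparr>"
    have sub: "parcs G \<subseteq> pverts G \<times> pverts G" using G.in_arcsD1 G.in_arcsD2 by auto
    have "inj_on (map_prod f f) (parcs G)"
      using map_prod_inj_on[OF inj inj] sub inj_on_subset by blast
    then have 1: "G.digraph_isomorphism h"
      using inj G.wf_digraph_axioms by (simp add: G.digraph_isomorphism_def h_def)
    have "parcs H = map_prod f f ` parcs G"
    proof
      show "parcs H \<subseteq> map_prod f f ` parcs G"
      proof
        fix e assume e: "e \<in> parcs H"
        obtain p q where pq: "e = (p, q)" by force
        with e have "p \<in> f ` pverts G" "q \<in> f ` pverts G"
          using H.in_arcsD1 H.in_arcsD2 V by auto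
        then obtain x y where "x \<in> pverts G" "y \<in> pverts G" "p = f x" "q = f y" by auto
        with e pq a show "e \<in> map_prod f f ` parcs G" by force
      qed
      show "map_prod f f ` parcs G \<subseteq> parcs H" using a sub by auto
    qed
    then have "with_proj H = app_iso h (with_proj G)"
      using V by (simp add: with_proj_def app_iso_def h_def)
    with 1 show ?L by (auto simp: digraph_iso_def)
  qed
qed

end

theory Submission
  imports Defs
begin

text \<open>
  Call a vertex together with a bijective labelling of its neighbours by $I=\{1,\dots,n\}$ a frame.
  Crossing the edge labelled $i$ transports the labels of the other neighbours through the
  quadrangles on that edge. The conditions $a_2=0$ and $c_3=3$ ensure that three neighbours of a
  vertex span a 3-cube, so that crossings with different labels commute: the group
  $\mathbb{F}_2^n$ acts on the frames, and following the vertices of the orbit of a frame at $u$ gives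
  a covering of $\Pi$ by $Q_n$. Automorphisms fixing $u$ lift to coordinate permutations. If they
  induce at least $A_n$, the fibre over $u$ is invariant under $A_n$, and as it contains no two
  points at distance 2 it is $\{\emptyset\}$ or $\{\emptyset,I\}$. In the second case a bijection
  commuting with the 3-cycles is trivial, so complementation preserves all fibres and $\Pi$ is the
  folded cube.
\<close>

section \<open>Completing quadrangles and cubes\<close>

text \<open>The obstacle is that a vertex carries no labels: a priori two sequences of crossings may
  end at the same vertex with different labellings of its neighbours. This is why the group acts on
  frames and the labelling is forgotten only at the end. It matters for the fibre consisting of {}
  and \<open>I\<close>: that these two sets lie over the same vertex says nothing about other sets,
  whereas equality of their frames survives every crossing. The 3-cycles are what upgrades the one
  to the other.

  Conversely, a coordinate permutation respects both unit steps and complementation, so it descends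
  to an automorphism of the cube or folded cube that fixes the image of {}. An automorphism fixing a
  vertex is determined by its effect on the labels there, so the stabiliser acts as the full
  symmetric group. The alternating group thus enters only as a lower bound for the action.\<close>

context rectagraph
begin

abbreviation adj :: "'a \<Rightarrow> 'a \<Rightarrow> bool" (infix \<open>\<sim>\<close> 50) where
  "x \<sim> y \<equiv> (x, y) \<in> parcs \<Gamma>"

lemma adj_sym: "x \<sim> y \<Longrightarrow> y \<sim> x"
  using pair_sym_arcs by (simp add: symmetric_def sym_def)

lemma adj_neq: "x \<sim> y \<Longrightarrow> x \<noteq> y"
  using pair_no_loops by fastforce

lemma not_triangle: "x \<sim> y \<Longrightarrow> y \<sim> z \<Longrightarrow> \<not> x \<sim> z"
  using triangle_free adj_sym by blast

lemma nbhd_iff: "y \<in> nbhd \<Gamma> x \<longleftrightarrow> x \<sim> y"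
  using in_arcsD2 by (auto simp: nbhd_def)

text \<open>Quadrangles are counted as edge sets, so uniqueness has to be passed on to the fourth
  vertex: the edge \<open>{b, x}\<close> must occur in the quadrangle built from \<open>y\<close>,
  where it can only be \<open>{b, y}\<close>.\<close>

lemma ex1_completion:
  assumes "v \<sim> a" "v \<sim> b" "a \<noteq> b"
  shows "\<exists>!x. x \<noteq> v \<and> x \<sim> a \<and> x \<sim> b"
proof -
  have *: "\<exists>!Q. quadrangle \<Gamma> Q \<and> {a, v} \<in> Q \<and> {v, b} \<in> Q"
    using assms in_arcsD1 by (intro unique_quadrangle) (auto simp: nbhd_iff)
  then obtain Q where Q: "quadrangle \<Gamma> Q" "{a, v} \<in> Q" "{v, b} \<in> Q" by blast
  then obtain p q r s where d: "distinct [p, q, r, s]"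
    and e: "p \<sim> q" "q \<sim> r" "r \<sim> s" "s \<sim> p"
    and Qe: "Q = {{p, q}, {q, r}, {r, s}, {s, p}}"
    unfolding quadrangle_def by blast
  have e': "q \<sim> p" "r \<sim> q" "s \<sim> r" "p \<sim> s" using e adj_sym by auto
  have ex: "\<exists>x. x \<noteq> v \<and> x \<sim> a \<and> x \<sim> b"
    using Q(2,3) d e e' assms(3) unfolding Qe by (auto simp: doubleton_eq_iff)
  have "x = y" if x: "x \<noteq> v" "x \<sim> a" "x \<sim> b" and y: "y \<noteq> v" "y \<sim> a" "y \<sim> b" for x y
  proof -
    have quad: "quadrangle \<Gamma> {{a, v}, {v, b}, {b, z}, {z, a}}"
      if "z \<noteq> v" "z \<sim> a" "z \<sim> b" for z
    proof -
      have "a \<noteq> v" "v \<noteq> b" "b \<noteq> z" "z \<noteq> a" "a \<sim> v" "b \<sim> z"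
        using that assms adj_sym adj_neq by blast+
      then show ?thesis
        unfolding quadrangle_def using that assms
        by (intro exI[of _ a] exI[of _ v] exI[of _ b] exI[of _ z]) simp
    qed
    have "{{a, v}, {v, b}, {b, x}, {x, a}} = {{a, v}, {v, b}, {b, y}, {y, a}}"
      by (rule ex1E[OF *]) (metis insertI1 insertI2 quad[OF x] quad[OF y])
    moreover have "{b, x} \<in> {{a, v}, {v, b}, {b, x}, {x, a}}" by simp
    ultimately have "{b, x} \<in> {{a, v}, {v, b}, {b, y}, {y, a}}" by (simp only:)
    then show ?thesis
      using x assms(3) adj_neq by (auto simp: doubleton_eq_iff)
  qed
  with ex show ?thesis by blast
qed

definition completion :: "'a \<Rightarrow> 'a \<Rightarrow> 'a \<Rightarrow> 'a" where
  "completion v a b = (THE x. x \<noteq> v \<and> x \<sim> a \<and> x \<sim> b)"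

lemma completion:
  assumes "v \<sim> a" "v \<sim> b" "a \<noteq> b"
  shows "completion v a b \<noteq> v" "completion v a b \<sim> a" "completion v a b \<sim> b"
    "a \<sim> completion v a b" "b \<sim> completion v a b"
  using theI'[OF ex1_completion[OF assms]] adj_sym by (auto simp: completion_def)

lemma completion_eqI:
  assumes "v \<sim> a" "v \<sim> b" "a \<noteq> b" "x \<noteq> v" "x \<sim> a" "x \<sim> b"
  shows "completion v a b = x"
  using ex1_completion[OF assms(1-3)] completion[OF assms(1-3)] assms(4-6) by blast

lemma completion_commute: "completion v a b = completion v b a"
  unfolding completion_def by (rule arg_cong[where f = The]) blast

lemma completion_completion:
  assumes "v \<sim> a" "v \<sim> b" "a \<noteq> b"
  shows "completion a v (completion v a b) = b"
  using assms completion[OF assms] adj_sym by (intro completion_eqI) auto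

text \<open>Seen from \<open>a\<close>, the vertices \<open>v\<close> and \<open>x\<close> are two
  neighbours, and both \<open>b\<close> and \<open>c\<close> complete them to a quadrangle. So two
  distinct vertices have at most two common neighbours.\<close>

lemma common_nbr_unique:
  assumes "v \<noteq> x" "v \<sim> a" "v \<sim> b" "v \<sim> c" "x \<sim> a" "x \<sim> b" "x \<sim> c" "a \<noteq> b" "a \<noteq> c"
  shows "b = c"
proof -
  have "completion a v x = b" "completion a v x = c"
    using assms adj_sym by (auto intro!: completion_eqI)
  then show ?thesis by simp
qed

text \<open>Without triangles, every 2-path with distinct ends is geodesic.\<close>

lemma sphere_2_iff:
  assumes "u \<in> pverts \<Gamma>"
  shows "v \<in> sphere \<Gamma> 2 u \<longleftrightarrow> u \<noteq> v \<and> (\<exists>w. u \<sim> w \<and> w \<sim> v)"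
  using not_triangle[of u _ v]
  by (auto simp: sphere_eq[OF assms] numeral_2_eq_2 less_Suc_eq relcomp_unfold)

lemma sphere_3I:
  assumes "u \<in> pverts \<Gamma>" "u \<sim> a" "a \<sim> b" "b \<sim> v"
    "u \<noteq> v" "\<not> u \<sim> v" "\<And>w. u \<sim> w \<Longrightarrow> \<not> w \<sim> v"
  shows "v \<in> sphere \<Gamma> 3 u"
  using assms(2-)
  by (auto simp: sphere_eq[OF assms(1)] numeral_3_eq_3 less_Suc_eq relcomp_unfold)

end

section \<open>Three neighbours of a vertex span a 3-cube\<close>

locale cubical_rectagraph = rectagraph +
  assumes a2: "a_const \<Gamma> 2 0" and c3: "c_const \<Gamma> 3 3"
begin

lemma not_adj_dist2:
  assumes "u \<sim> a" "a \<sim> x" "u \<noteq> x" "u \<sim> b" "b \<sim> y" "u \<noteq> y"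
  shows "\<not> x \<sim> y"
proof
  assume xy: "x \<sim> y"
  have u: "u \<in> pverts \<Gamma>" using assms(1) in_arcsD1 by blast
  have "x \<in> sphere \<Gamma> 2 u" "y \<in> sphere \<Gamma> 2 u"
    using assms by (auto simp: sphere_2_iff[OF u])
  then have "card (sphere \<Gamma> 2 u \<inter> nbhd \<Gamma> x) = 0" "y \<in> sphere \<Gamma> 2 u \<inter> nbhd \<Gamma> x"
    using a2 u xy by (auto simp: a_const_def nbhd_iff)
  moreover have "finite (sphere \<Gamma> 2 u \<inter> nbhd \<Gamma> x)"
    using pair_finite_verts by (rule rev_finite_subset) (auto simp: nbhd_def)
  ultimately show False by auto
qed

lemma dist3_nbrs_card:
  assumes "u \<in> pverts \<Gamma>" "x \<in> sphere \<Gamma> 3 u"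
  shows "card {y. x \<sim> y \<and> u \<noteq> y \<and> (\<exists>w. u \<sim> w \<and> w \<sim> y)} = 3"
proof -
  have "sphere \<Gamma> 2 u \<inter> nbhd \<Gamma> x = {y. x \<sim> y \<and> u \<noteq> y \<and> (\<exists>w. u \<sim> w \<and> w \<sim> y)}"
    by (auto simp: sphere_2_iff[OF assms(1)] nbhd_iff)
  then show ?thesis using c3 assms unfolding c_const_def by fastforce
qed

text \<open>An edge from \<open>w\<close> to \<open>x\<close> would make \<open>x\<close> a common
  neighbour of \<open>w\<close> and \<open>w12\<close> other than \<open>w1\<close>, hence
  \<open>x = w2\<close>, and in the same way \<open>x = w3\<close>. Distance 2 is excluded by a_2 =
  0, since \<open>x\<close> is adjacent to \<open>w12\<close>, which has distance 2 from
  \<open>w\<close>.\<close>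

lemma cube_corner_dist3:
  assumes w: "w \<sim> w1" "w \<sim> w2" "w \<sim> w3" and d: "w1 \<noteq> w2" "w1 \<noteq> w3" "w2 \<noteq> w3"
    and w12: "w12 \<noteq> w" "w12 \<sim> w1" "w12 \<sim> w2"
    and w13: "w13 \<noteq> w" "w13 \<sim> w1" "w13 \<sim> w3"
    and x: "x \<noteq> w1" "x \<sim> w12" "x \<sim> w13"
  shows "x \<in> sphere \<Gamma> 3 w"
proof (rule sphere_3I[of w w1 w12 x])
  show "w \<in> pverts \<Gamma>" "w \<sim> w1" "w1 \<sim> w12" "w12 \<sim> x"
    using assms in_arcsD1 adj_sym by blast+
  show "w \<noteq> x"
    using w(1) w12(2) x(2) not_triangle adj_sym by blast
  show "\<not> w \<sim> x"
  proof
    assume wx: "w \<sim> x"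
    then have "x = w2"
      using common_nbr_unique[of w w12 w1 x w2] w w12 x d adj_sym by metis
    then have "x = w3"
      using common_nbr_unique[of w w13 w1 x w3] w w13 x d wx adj_sym by metis
    then show False using \<open>x = w2\<close> d by simp
  qed
  then show "\<not> y \<sim> x" if "w \<sim> y" for y
    using not_adj_dist2[of w w1 w12 y x] that w w12 x adj_sym \<open>w \<noteq> x\<close> by blast
qed

text \<open>By c_3 = 3 the vertex \<open>x\<close> has, besides \<open>w12\<close> and
  \<open>w13\<close>, exactly one more neighbour \<open>z\<close> at distance 2 from
  \<open>w\<close>. It turns out to be adjacent to \<open>w2\<close> and to \<open>w3\<close>, so it
  is the corner \<open>w23\<close> over these two.\<close>

lemma cube_completion:
  assumes w: "w \<sim> w1" "w \<sim> w2" "w \<sim> w3" and d: "w1 \<noteq> w2" "w1 \<noteq> w3" "w2 \<noteq> w3"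
    and w12: "w12 \<noteq> w" "w12 \<sim> w1" "w12 \<sim> w2"
    and w13: "w13 \<noteq> w" "w13 \<sim> w1" "w13 \<sim> w3"
    and w23: "w23 \<noteq> w" "w23 \<sim> w2" "w23 \<sim> w3"
    and x: "x \<noteq> w1" "x \<sim> w12" "x \<sim> w13"
  shows "x \<sim> w23"
proof -
  have x3: "x \<in> sphere \<Gamma> 3 w"
    using w d w12 w13 x by (rule cube_corner_dist3)
  have wV: "w \<in> pverts \<Gamma>" using w in_arcsD1 by blast
  have not1: "\<not> w' \<sim> x" if "w \<sim> w'" for w'
    using x3 that by (auto simp: sphere_eq[OF wV] numeral_3_eq_3 less_Suc_eq relcomp_unfold)
  have ne: "w12 \<noteq> w13"
    using common_nbr_unique[of w w12 w1 w2 w3] w w12 w13 d by blast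
  let ?D = "{y. x \<sim> y \<and> w \<noteq> y \<and> (\<exists>v. w \<sim> v \<and> v \<sim> y)}"
  have card: "card ?D = 3" using dist3_nbrs_card[OF wV x3] .
  have inD: "w12 \<in> ?D" "w13 \<in> ?D"
    using w w12 w13 x adj_sym by blast+
  obtain z where D: "?D = {w12, w13, z}"
  proof -
    have "card (?D - {w12, w13}) = 1" using card inD ne by (simp add: card_Diff_subset)
    then obtain z where "?D - {w12, w13} = {z}" by (rule card_1_singletonE)
    then show thesis using inD that[of z] by blast
  qed
  \<comment> \<open>Completing the 2-arc \<open>v\<close>, \<open>p\<close>, \<open>x\<close> gives
    a neighbour of \<open>x\<close> at distance 2 from \<open>w\<close>. It is not \<open>p\<close>,
    and not \<open>q\<close> because it is adjacent to \<open>v\<close>; so it is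
    \<open>z\<close>.\<close>
  have third: "z \<sim> v" if v: "w \<sim> v" "v \<sim> p" "p \<in> {w12, w13}" "\<not> v \<sim> q" "{p, q} = {w12, w13}" for v p q
  proof -
    have px: "p \<sim> v" "p \<sim> x" "v \<noteq> x" using v x adj_sym not1 by (auto simp: doubleton_eq_iff)
    let ?y = "completion p v x"
    have y: "?y \<noteq> p" "?y \<sim> v" "?y \<sim> x" using completion[OF px] by auto
    then have "w \<noteq> ?y" using not1[of v] v(1) x3 by (auto simp: sphere_eq[OF wV] numeral_3_eq_3 less_Suc_eq)
    then have "?y \<in> ?D" using y v(1) adj_sym by blast
    then show ?thesis using D y v adj_sym by (auto simp: doubleton_eq_iff)
  qed
  have "\<not> w2 \<sim> w13" "\<not> w3 \<sim> w12"
    using common_nbr_unique[of w w13 w1 w3 w2] common_nbr_unique[of w w12 w1 w2 w3] w w12 w13 d adj_sym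
    by metis+
  then have "z \<sim> w2" "z \<sim> w3"
    using third[of w2 w12 w13] third[of w3 w13 w12] w w12 w13 adj_sym by auto
  moreover have "x \<sim> z" "z \<noteq> w" using D by auto
  ultimately show ?thesis
    using completion_eqI[of w w2 w3] w d w23 by metis
qed

end

section \<open>Labelled vertices and the covering by the cube\<close>

text \<open>Adding the \<open>i\<close>-th unit vector, when subsets stand for vectors over the
  field with two elements.\<close>

definition flip :: "'i \<Rightarrow> 'i set \<Rightarrow> 'i set" where
  "flip i S = (if i \<in> S then S - {i} else insert i S)"

lemma flip_subset: "S \<subseteq> I \<Longrightarrow> i \<in> I \<Longrightarrow> flip i S \<subseteq> I"
  by (auto simp: flip_def)

lemma flip_flip [simp]: "flip i (flip i S) = S"
  by (auto simp: flip_def)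

lemma flip_Compl: "i \<in> I \<Longrightarrow> flip i (I - S) = I - flip i S"
  by (auto simp: flip_def)

lemma flip_image: "inj \<sigma> \<Longrightarrow> flip (\<sigma> i) (\<sigma> ` S) = \<sigma> ` flip i S"
  by (auto simp: flip_def inj_image_mem_iff dest: injD)

section \<open>Frames and their transport across edges\<close>

locale framed_rectagraph = cubical_rectagraph +
  fixes I :: "'i set" and u :: 'a and l :: "'i \<Rightarrow> 'a"
  assumes finite_I: "finite I" and base_vertex: "u \<in> pverts \<Gamma>"
    and base_labels: "bij_betw l I (nbhd \<Gamma> u)"
begin

definition frame :: "'a \<times> ('i \<Rightarrow> 'a) \<Rightarrow> bool" where
  "frame F \<longleftrightarrow> fst F \<in> pverts \<Gamma> \<and> bij_betw (snd F) I (nbhd \<Gamma> (fst F)) \<and> snd F \<in> extensional I"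

text \<open>The edge just crossed keeps its label, now pointing back, so that crossing
  \<open>i\<close> again returns to the old vertex. The restriction to \<open>I\<close> makes frames
  equal as soon as their vertices and their labels on \<open>I\<close> agree.\<close>

definition move :: "'i \<Rightarrow> 'a \<times> ('i \<Rightarrow> 'a) \<Rightarrow> 'a \<times> ('i \<Rightarrow> 'a)" where
  "move i F = (snd F i, \<lambda>j\<in>I. if j = i then fst F else completion (fst F) (snd F i) (snd F j))"

lemma fst_move [simp]: "fst (move i F) = snd F i"
  and snd_move: "j \<in> I \<Longrightarrow>
    snd (move i F) j = (if j = i then fst F else completion (fst F) (snd F i) (snd F j))"
  and extensional_move [simp]: "snd (move i F) \<in> extensional I"
  by (auto simp: move_def)

lemma frame_adj: "frame F \<Longrightarrow> i \<in> I \<Longrightarrow> fst F \<sim> snd F i"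
  by (auto simp: frame_def bij_betw_def nbhd_iff)

lemma frame_label: "frame F \<Longrightarrow> fst F \<sim> a \<Longrightarrow> \<exists>i\<in>I. snd F i = a"
  unfolding frame_def bij_betw_def by (metis imageE nbhd_iff)

lemma frame_inj: "frame F \<Longrightarrow> i \<in> I \<Longrightarrow> j \<in> I \<Longrightarrow> snd F i = snd F j \<longleftrightarrow> i = j"
  by (auto simp: frame_def bij_betw_def dest: inj_onD)

lemma frame_eqI:
  assumes "snd F \<in> extensional I" "snd F' \<in> extensional I"
    and "fst F = fst F'" "\<And>i. i \<in> I \<Longrightarrow> snd F i = snd F' i"
  shows "F = F'"
  using assms by (auto simp: prod_eq_iff intro: extensionalityI)

text \<open>By \<open>completion_completion\<close>, transport across the edge from \<open>v\<close>
  to \<open>w\<close> is undone by transport back. So different labels stay different, and a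
  neighbour \<open>y\<close> of \<open>w\<close> other than \<open>v\<close> comes from the
  completion of \<open>v\<close> and \<open>y\<close> at \<open>w\<close>.\<close>

lemma frame_move:
  assumes F: "frame F" and i: "i \<in> I"
  shows "frame (move i F)"
proof -
  define v w where "v = fst F" and "w = snd F i"
  have vw: "v \<sim> w" using frame_adj[OF F i] by (simp add: v_def w_def)
  have lab: "snd (move i F) j = completion v w (snd F j)" if "j \<in> I" "j \<noteq> i" for j
    using that by (simp add: snd_move v_def w_def)
  have lab_i: "snd (move i F) i = v" using i by (simp add: snd_move v_def)
  have nbr: "v \<sim> snd F j" if "j \<in> I" for j
    using frame_adj[OF F that] by (simp add: v_def)
  have ne: "w \<noteq> snd F j" if "j \<in> I" "j \<noteq> i" for j
    using that i frame_inj[OF F, of i j] by (simp add: w_def)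
  have "inj_on (snd (move i F)) I"
  proof (rule inj_onI)
    fix j k assume jk: "j \<in> I" "k \<in> I" and eq: "snd (move i F) j = snd (move i F) k"
    show "j = k"
    proof (cases "j = i \<or> k = i")
      case True
      then show ?thesis
        using eq jk lab lab_i completion(1)[OF vw nbr ne] by metis
    next
      case False
      then have "snd F j = snd F k"
        using eq jk lab completion_completion[OF vw nbr ne] by metis
      then show ?thesis using frame_inj[OF F] jk by blast
    qed
  qed
  moreover have "snd (move i F) ` I = nbhd \<Gamma> w"
  proof (intro equalityI subsetI)
    fix y assume "y \<in> snd (move i F) ` I"
    then obtain j where j: "j \<in> I" "y = snd (move i F) j" by blast
    show "y \<in> nbhd \<Gamma> w"
    proof (cases "j = i")
      case True
      then show ?thesis using j lab_i adj_sym[OF vw] by (simp add: nbhd_iff)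
    next
      case False
      then show ?thesis
        using j lab completion(4)[OF vw nbr ne, of j] by (simp add: nbhd_iff)
    qed
  next
    fix y assume y: "y \<in> nbhd \<Gamma> w"
    show "y \<in> snd (move i F) ` I"
    proof (cases "y = v")
      case True
      then show ?thesis using lab_i i by (metis imageI)
    next
      case False
      have wy: "w \<sim> v" "w \<sim> y" "v \<noteq> y" using vw y adj_sym False by (auto simp: nbhd_iff)
      note c = completion[OF wy]
      obtain j where j: "j \<in> I" "snd F j = completion w v y"
        using frame_label[OF F] c(4) v_def by blast
      then have "j \<noteq> i" using c(1) by (auto simp: w_def)
      then have "snd (move i F) j = y"
        using j lab completion_completion[OF wy] by simp
      then show ?thesis using j(1) by (metis imageI)
    qed
  qed
  moreover have "w \<in> pverts \<Gamma>" using vw in_arcsD2 by blast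
  ultimately show ?thesis
    by (simp add: frame_def bij_betw_def w_def)
qed

lemma move_move:
  assumes F: "frame F" and i: "i \<in> I"
  shows "move i (move i F) = F"
proof (rule frame_eqI)
  show "snd F \<in> extensional I" using F by (simp add: frame_def)
  show "fst (move i (move i F)) = fst F" using i by (simp add: snd_move)
  show "snd (move i (move i F)) j = snd F j" if j: "j \<in> I" for j
  proof (cases "j = i")
    case True
    then show ?thesis using i by (simp add: snd_move)
  next
    case False
    then have "completion (snd F i) (fst F) (completion (fst F) (snd F i) (snd F j)) = snd F j"
      using F i j frame_adj frame_inj by (intro completion_completion) auto
    then show ?thesis using False i j by (simp add: snd_move)
  qed
qed simp

text \<open>Both orders reach the same vertex because completion is symmetric, and the labels
  \<open>i\<close> and \<open>j\<close> are settled inside one quadrangle. A third label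
  \<open>k\<close> marks the corner opposite to \<open>v\<close> in the 3-cube spanned by three
  neighbours; by \<open>cube_completion\<close> it is the same corner whether reached through
  \<open>w i\<close> or through \<open>w j\<close>.\<close>

lemma move_commute:
  assumes F: "frame F" and i: "i \<in> I" and j: "j \<in> I"
  shows "move i (move j F) = move j (move i F)"
proof (cases "i = j")
  case False
  define v where "v = fst F"
  define w where "w k = snd F k" for k
  define c where "c k k' = completion v (w k) (w k')" for k k'
  have adj: "v \<sim> w k" if "k \<in> I" for k
    using frame_adj[OF F that] by (simp add: v_def w_def)
  have ne: "w k \<noteq> w k'" if "k \<in> I" "k' \<in> I" "k \<noteq> k'" for k k'
    using frame_inj[OF F] that by (simp add: w_def)
  note c = completion[OF adj adj ne, folded c_def]
  have lab: "snd (move k F) k' = c k k'" if "k' \<in> I" "k' \<noteq> k" for k k'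
    using that by (simp add: snd_move c_def v_def w_def)
  have lab': "snd (move k F) k = v" if "k \<in> I" for k
    using that by (simp add: snd_move v_def)
  have com: "c i j = c j i" using completion_commute by (simp add: c_def)
  show ?thesis
  proof (rule frame_eqI)
    show "fst (move i (move j F)) = fst (move j (move i F))"
      using False i j lab com by simp
    show "snd (move i (move j F)) k = snd (move j (move i F)) k" if k: "k \<in> I" for k
    proof -
      have swap: "snd (move k (move k' F)) k = snd (move k' (move k F)) k"
        if "k \<in> I" "k' \<in> I" "k \<noteq> k'" for k k'
      proof -
        have "snd (move k (move k' F)) k = w k'"
          using that by (simp add: snd_move[of k k "move k' F"] w_def)
        moreover have "snd (move k' (move k F)) k = completion (w k) (c k k') v"
          using that by (simp add: snd_move[of k k' "move k F"] lab lab') (simp add: w_def)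
        moreover have "completion (w k) (c k k') v = w k'"
          using completion_completion[OF adj adj ne] that
            completion_commute[of "w k" "c k k'" v]
          by (simp add: c_def)
        ultimately show ?thesis by simp
      qed
      consider "k = i" | "k = j" | "k \<noteq> i" "k \<noteq> j" by blast
      then show ?thesis
      proof cases
        case 1
        then show ?thesis using swap[of i j] i j False by simp
      next
        case 2
        then show ?thesis using swap[of j i] i j False by simp
      next
        case 3
        \<comment> \<open>Label \<open>k\<close> after crossing \<open>i\<close> and then
          \<open>j\<close>. To serve for the other order it must be adjacent to
          \<open>c j k\<close>, which is where the 3-cube enters, and differ from
          \<open>w j\<close>, which follows from its distance 3 to \<open>v\<close>.\<close>
        let ?x = "completion (w i) (c i j) (c i k)"
        have "c i j \<noteq> c i k"
        proof
          assume "c i j = c i k"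
          then have "w j = w k"
            using common_nbr_unique[of v "c i j" "w i" "w j" "w k"] adj ne c i j k 3 False by metis
          then show False using ne j k 3 by blast
        qed
        then have x: "?x \<noteq> w i" "?x \<sim> c i j" "?x \<sim> c i k"
          using completion[of "w i" "c i j" "c i k"] c i j k 3 False by auto
        have xjk: "?x \<sim> c j k"
          using cube_completion[of v "w i" "w j" "w k" "c i j" "c i k" "c j k" ?x]
            adj ne c i j k 3 False x by metis
        have "?x \<in> sphere \<Gamma> 3 v"
          using cube_corner_dist3[of v "w i" "w j" "w k" "c i j" "c i k" ?x]
            adj ne c i j k 3 False x by metis
        then have "?x \<noteq> w j"
          using adj[OF j] in_arcsD1 by (auto simp: sphere_eq numeral_3_eq_3 less_Suc_eq)
        moreover have "c j i \<noteq> c j k"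
        proof
          assume "c j i = c j k"
          then have "w i = w k"
            using common_nbr_unique[of v "c j i" "w j" "w i" "w k"] adj ne c i j k 3 False by metis
          then show False using ne i k 3 by blast
        qed
        ultimately have "completion (w j) (c j i) (c j k) = ?x"
          using c i j k 3 False x xjk com by (intro completion_eqI) auto
        then show ?thesis
          using i j k 3 False by (simp add: snd_move[of k _ "move _ F"] lab) (simp add: w_def)
      qed
    qed
  qed simp_all
qed simp

text \<open>\<open>move\<close> extended by the identity, because \<open>comp_fun_commute\<close>
  asks for commutation on the whole type.\<close>

definition step :: "'i \<Rightarrow> 'a \<times> ('i \<Rightarrow> 'a) \<Rightarrow> 'a \<times> ('i \<Rightarrow> 'a)" where
  "step i F = (if frame F \<and> i \<in> I then move i F else F)"

sublocale step: comp_fun_commute step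
  by unfold_locales (auto simp: step_def fun_eq_iff frame_move move_commute)

section \<open>The covering by the cube of label sets\<close>

definition lift :: "'i set \<Rightarrow> 'a \<times> ('i \<Rightarrow> 'a)" where
  "lift S = Finite_Set.fold step (u, restrict l I) S"

definition cover :: "'i set \<Rightarrow> 'a" where
  "cover S = fst (lift S)"

lemma frame_lift:
  assumes "S \<subseteq> I"
  shows "frame (lift S)"
  using finite_subset[OF assms finite_I] assms
proof (induction S rule: finite_induct)
  case empty
  have "bij_betw (restrict l I) I (nbhd \<Gamma> u)"
    using base_labels by (simp cong: bij_betw_cong)
  then show ?case using base_vertex by (simp add: lift_def frame_def)
next
  case (insert i S)
  then show ?case by (simp add: lift_def step_def frame_move)
qed

lemma lift_insert:
  assumes "S \<subseteq> I" "i \<in> I" "i \<notin> S"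
  shows "lift (insert i S) = move i (lift S)"
  using frame_lift[OF assms(1)] finite_subset[OF assms(1) finite_I] assms(2,3)
  by (simp add: lift_def step_def)

text \<open>Moves are involutions, so removing a label is a crossing just as adding one is.\<close>

lemma lift_flip:
  assumes S: "S \<subseteq> I" and i: "i \<in> I"
  shows "lift (flip i S) = move i (lift S)"
proof (cases "i \<in> S")
  case True
  have "S - {i} \<subseteq> I" using S by blast
  then show ?thesis
    using lift_insert[of "S - {i}" i] move_move[OF frame_lift i] True i
    by (simp add: flip_def insert_absorb)
next
  case False
  then show ?thesis using lift_insert S i by (simp add: flip_def)
qed

text \<open>The labels of the frame over \<open>S\<close> are the images of the cube neighbours of
  \<open>S\<close>. So bijectivity of the labelling becomes local bijectivity of
  \<open>cover\<close>, recorded in \<open>cover_adj\<close>, \<open>cover_nbr\<close> and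
  \<open>cover_inj\<close>.\<close>

lemma snd_lift: "S \<subseteq> I \<Longrightarrow> i \<in> I \<Longrightarrow> snd (lift S) i = cover (flip i S)"
  by (simp add: cover_def lift_flip)

lemma cover_empty [simp]: "cover {} = u"
  by (simp add: cover_def lift_def)

lemma cover_vertex: "S \<subseteq> I \<Longrightarrow> cover S \<in> pverts \<Gamma>"
  using frame_lift by (simp add: cover_def frame_def)

lemma cover_adj: "S \<subseteq> I \<Longrightarrow> i \<in> I \<Longrightarrow> cover S \<sim> cover (flip i S)"
  using frame_adj[OF frame_lift] snd_lift by (metis cover_def)

lemma cover_nbr: "S \<subseteq> I \<Longrightarrow> cover S \<sim> y \<Longrightarrow> \<exists>i\<in>I. y = cover (flip i S)"
  using frame_label[OF frame_lift] snd_lift by (metis cover_def)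

lemma cover_inj:
  "S \<subseteq> I \<Longrightarrow> i \<in> I \<Longrightarrow> j \<in> I \<Longrightarrow> cover (flip i S) = cover (flip j S) \<longleftrightarrow> i = j"
  using frame_inj[OF frame_lift] snd_lift by metis

text \<open>Connectedness and path lifting: every edge leaving \<open>cover S\<close> is the image
  of a cube edge leaving \<open>S\<close>.\<close>

lemma cover_surj: "cover ` Pow I = pverts \<Gamma>"
proof
  show "pverts \<Gamma> \<subseteq> cover ` Pow I"
  proof
    fix v assume v: "v \<in> pverts \<Gamma>"
    have "strongly_connected (with_proj \<Gamma>)"
      using symmetric_connected_imp_strongly_connected pair_sym_arcs connected by blast
    then have "u \<rightarrow>\<^sup>*\<^bsub>with_proj \<Gamma>\<^esub> v"
      using v base_vertex by (auto simp: strongly_connected_def)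
    then show "v \<in> cover ` Pow I"
    proof (induction rule: reachable_induct)
      case base
      then show ?case using cover_empty by (metis Pow_bottom imageI)
    next
      case (step x y)
      then obtain S where "S \<subseteq> I" "cover S \<sim> y" by auto
      then show ?case using cover_nbr flip_subset by (metis PowI imageI)
    qed
  qed
qed (use cover_vertex in auto)

text \<open>An automorphism fixing \<open>u\<close> is determined by its action on the labels, since it preserves
  quadrangles and therefore commutes with the transport of frames.\<close>

lemma lift_equivariant:
  assumes aut: "bij_betw g (pverts \<Gamma>) (pverts \<Gamma>)"
      "\<And>x y. x \<in> pverts \<Gamma> \<Longrightarrow> y \<in> pverts \<Gamma> \<Longrightarrow> g x \<sim> g y \<longleftrightarrow> x \<sim> y"
    and gu: "g u = u" and perm: "\<sigma> permutes I" and gl: "\<And>i. i \<in> I \<Longrightarrow> g (l i) = l (\<sigma> i)"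
    and S: "S \<subseteq> I"
  shows "cover (\<sigma> ` S) = g (cover S) \<and> (\<forall>i\<in>I. snd (lift (\<sigma> ` S)) (\<sigma> i) = g (snd (lift S) i))"
  using finite_subset[OF S finite_I] S
proof (induction S rule: finite_induct)
  case empty
  then show ?case
    using gu gl permutes_in_image[OF perm] by (simp add: lift_def)
next
  case (insert i S)
  have S: "S \<subseteq> I" "i \<in> I" using insert.prems by auto
  have \<sigma>S: "\<sigma> ` S \<subseteq> I" "\<sigma> i \<in> I" "\<sigma> i \<notin> \<sigma> ` S"
    using S permutes_in_image[OF perm] permutes_inj[OF perm] insert.hyps
    by (auto simp: inj_image_mem_iff)
  have IH: "fst (lift (\<sigma> ` S)) = g (fst (lift S))"
    "\<And>j. j \<in> I \<Longrightarrow> snd (lift (\<sigma> ` S)) (\<sigma> j) = g (snd (lift S) j)"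
    using insert.IH S by (auto simp: cover_def)
  have e: "lift (insert i S) = move i (lift S)"
    "lift (\<sigma> ` insert i S) = move (\<sigma> i) (lift (\<sigma> ` S))"
    using lift_insert S \<sigma>S insert.hyps by auto
  have g_compl: "completion (g v) (g a) (g b) = g (completion v a b)"
    if vab: "v \<sim> a" "v \<sim> b" "a \<noteq> b" for v a b
  proof -
    note c = completion[OF vab]
    have V: "v \<in> pverts \<Gamma>" "a \<in> pverts \<Gamma>" "b \<in> pverts \<Gamma>" "completion v a b \<in> pverts \<Gamma>"
      using vab c in_arcsD1 in_arcsD2 by blast+
    have "g a \<noteq> g b" "g (completion v a b) \<noteq> g v"
      using V vab c aut(1) by (auto simp: bij_betw_def dest: inj_onD)
    then show ?thesis
      using vab V c aut(2) by (intro completion_eqI) auto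
  qed
  have "snd (lift (\<sigma> ` insert i S)) (\<sigma> j) = g (snd (lift (insert i S)) j)" if j: "j \<in> I" for j
  proof (cases "j = i")
    case True
    then show ?thesis using e S \<sigma>S IH by (simp add: snd_move)
  next
    case False
    then have "\<sigma> j \<noteq> \<sigma> i" using permutes_inj[OF perm] by (auto dest: injD)
    moreover have "completion (g (fst (lift S))) (g (snd (lift S) i)) (g (snd (lift S) j))
        = g (completion (fst (lift S)) (snd (lift S) i) (snd (lift S) j))"
      using frame_lift[OF S(1)] S j False frame_adj frame_inj by (intro g_compl) auto
    ultimately show ?thesis
      using e S \<sigma>S IH j False permutes_in_image[OF perm] by (simp add: snd_move)
  qed
  then show ?case using e IH(2)[OF S(2)] by (simp add: cover_def)
qed

end

section \<open>The fibres of the covering\<close>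

definition three_cycle :: "'i \<Rightarrow> 'i \<Rightarrow> 'i \<Rightarrow> 'i \<Rightarrow> 'i" where
  "three_cycle a b c = transpose a b \<circ> transpose b c"

lemma three_cycle_apply:
  assumes "distinct [a, b, c]"
  shows "three_cycle a b c a = b" "three_cycle a b c b = c" "three_cycle a b c c = a"
    "x \<notin> {a, b, c} \<Longrightarrow> three_cycle a b c x = x"
  using assms by (auto simp: three_cycle_def transpose_def)

lemma three_cycle_permutes: "{a, b, c} \<subseteq> I \<Longrightarrow> three_cycle a b c permutes I"
  unfolding three_cycle_def by (intro permutes_compose permutes_swap_id) auto

lemma evenperm_three_cycle: "distinct [a, b, c] \<Longrightarrow> evenperm (three_cycle a b c)"
  unfolding three_cycle_def
  by (subst evenperm_comp) (auto simp: evenperm_swap permutation_swap_id)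

text \<open>Swapping \<open>i\<close> and \<open>j\<close> would do but is odd. A third label turns
  the swap into a 3-cycle, whose orientation depends on the side of \<open>S\<close> on which
  \<open>k\<close> lies, so that \<open>k\<close> does not change sides.\<close>

lemma ex_evenperm_exchange:
  assumes "i \<in> S" "j \<in> I - S" "k \<in> I" "k \<noteq> i" "k \<noteq> j" "S \<subseteq> I"
  shows "\<exists>\<sigma>. \<sigma> permutes I \<and> evenperm \<sigma> \<and> \<sigma> ` S = flip i (flip j S)"
proof (cases "k \<in> S")
  case True
  let ?\<sigma> = "three_cycle i k j"
  have d: "distinct [i, k, j]" using assms by auto
  note ap = three_cycle_apply[OF d]
  have R: "?\<sigma> ` (S - {i, k}) = S - {i, k}"
    using ap(4) assms(2) by (intro trans[OF image_cong[OF refl] image_ident]) auto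
  have "S = insert i (insert k (S - {i, k}))" using True assms by blast
  then have "?\<sigma> ` S = insert (?\<sigma> i) (insert (?\<sigma> k) (?\<sigma> ` (S - {i, k})))"
    by (metis image_insert)
  also have "\<dots> = flip i (flip j S)"
    using True assms by (auto simp: ap R flip_def)
  finally show ?thesis
    using d assms three_cycle_permutes[of i k j I] evenperm_three_cycle[OF d] by blast
next
  case False
  let ?\<sigma> = "three_cycle i j k"
  have d: "distinct [i, j, k]" using assms by auto
  note ap = three_cycle_apply[OF d]
  have R: "?\<sigma> ` (S - {i}) = S - {i}"
    using ap(4) assms(2) False by (intro trans[OF image_cong[OF refl] image_ident]) auto
  have "S = insert i (S - {i})" using assms by blast
  then have "?\<sigma> ` S = insert (?\<sigma> i) (?\<sigma> ` (S - {i}))"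
    by (metis image_insert)
  also have "\<dots> = flip i (flip j S)"
    using False assms by (auto simp: ap R flip_def)
  finally show ?thesis
    using d assms three_cycle_permutes[of i j k I] evenperm_three_cycle[OF d] by blast
qed

text \<open>Presents the graph as the power set of \<open>I\<close> with unit steps, or as its
  quotient by complementation. The data \<open>I\<close> and \<open>folded\<close> fix the graph up
  to isomorphism, which lets the cube and the folded cube share their proofs.\<close>

definition cube_model :: "'a pair_pre_digraph \<Rightarrow> 'i set \<Rightarrow> bool \<Rightarrow> ('i set \<Rightarrow> 'a) \<Rightarrow> bool" where
  "cube_model \<Gamma> I folded p \<longleftrightarrow> p ` Pow I = pverts \<Gamma> \<and>
    (\<forall>S\<in>Pow I. \<forall>T\<in>Pow I. p S = p T \<longleftrightarrow> T = S \<or> folded \<and> T = I - S) \<and>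
    (\<forall>S\<in>Pow I. \<forall>T\<in>Pow I. (p S, p T) \<in> parcs \<Gamma> \<longleftrightarrow> (\<exists>i\<in>I. p (flip i S) = p T))"

section \<open>Number of labels and shape of the fibres\<close>

context framed_rectagraph
begin

text \<open>Distance 2 from \<open>u\<close>, spelled out as in \<open>sphere_2_iff\<close>. It is
  used with \<open>S = {}\<close> and, when \<open>I\<close> also lies over \<open>u\<close>, with
  \<open>S = I\<close>, so that large sets are measured from \<open>u\<close> as well as small
  ones.\<close>

lemma cover_two_steps:
  assumes S: "S \<subseteq> I" "cover S = u" and ij: "i \<in> I" "j \<in> I" "i \<noteq> j"
  shows "u \<noteq> cover (flip j (flip i S)) \<and> (\<exists>w. u \<sim> w \<and> w \<sim> cover (flip j (flip i S)))"
proof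
  have "cover (flip i (flip i S)) \<noteq> cover (flip j (flip i S))"
    using cover_inj flip_subset S ij by metis
  then show "u \<noteq> cover (flip j (flip i S))" using S by simp
  show "\<exists>w. u \<sim> w \<and> w \<sim> cover (flip j (flip i S))"
    using cover_adj flip_subset S ij by metis
qed

lemma cover_pair:
  assumes "i \<in> I" "j \<in> I" "i \<noteq> j"
  shows "u \<noteq> cover {i, j}" "\<exists>w. u \<sim> w \<and> w \<sim> cover {i, j}"
  using cover_two_steps[of "{}" j i] assms by (auto simp: flip_def)

lemma cover_not_pair:
  assumes "cover I = u" "i \<in> I" "j \<in> I" "i \<noteq> j"
  shows "u \<noteq> cover (I - {i, j})" "\<exists>w. u \<sim> w \<and> w \<sim> cover (I - {i, j})"
proof -
  have "flip i (flip j I) = I - {i, j}" using assms by (auto simp: flip_def)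
  then show "u \<noteq> cover (I - {i, j})" "\<exists>w. u \<sim> w \<and> w \<sim> cover (I - {i, j})"
    using cover_two_steps[of I j i] assms by auto
qed

lemma cover_adj_insert: "S \<subseteq> I \<Longrightarrow> i \<in> I \<Longrightarrow> i \<notin> S \<Longrightarrow> cover S \<sim> cover (insert i S)"
  using cover_adj[of S i] by (simp add: flip_def)

lemma cover_inj_insert:
  "S \<subseteq> I \<Longrightarrow> i \<in> I - S \<Longrightarrow> j \<in> I - S \<Longrightarrow> i \<noteq> j \<Longrightarrow> cover (insert i S) \<noteq> cover (insert j S)"
  using cover_inj[of S i j] by (simp add: flip_def)

lemma cover_triple_dist3:
  assumes "distinct [i, j, k]" "{i, j, k} \<subseteq> I"
  shows "cover {i, j, k} \<in> sphere \<Gamma> 3 u"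
proof (rule cube_corner_dist3[of u "cover {i}" "cover {j}" "cover {k}" "cover {i, j}" "cover {i, k}"])
  have a: "cover S \<sim> cover (insert x S)" "cover (insert x S) \<sim> cover S"
    if "S \<subseteq> I" "x \<in> I" "x \<notin> S" for S x
    using cover_adj_insert[OF that] adj_sym by auto
  show "u \<sim> cover {i}" "u \<sim> cover {j}" "u \<sim> cover {k}"
    using a(1)[of "{}"] assms by auto
  show "cover {i} \<noteq> cover {j}" "cover {i} \<noteq> cover {k}" "cover {j} \<noteq> cover {k}"
    using cover_inj_insert[of "{}"] assms by auto
  show "cover {i, j} \<noteq> u" "cover {i, k} \<noteq> u"
    using cover_pair(1)[of i j] cover_pair(1)[of i k] assms by auto
  show "cover {i, j} \<sim> cover {i}" "cover {i, k} \<sim> cover {i}" "cover {i, j} \<sim> cover {j}" "cover {i, k} \<sim> cover {k}"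
    using a(2)[of "{i}" j] a(2)[of "{i}" k] a(2)[of "{j}" i] a(2)[of "{k}" i] assms
    by (auto simp: insert_commute)
  show "cover {i, j, k} \<sim> cover {i, j}" "cover {i, j, k} \<sim> cover {i, k}"
    using a(2)[of "{i, j}" k] a(2)[of "{i, k}" j] assms by (auto simp: insert_commute)
  show "cover {i, j, k} \<noteq> cover {i}"
  proof
    assume "cover {i, j, k} = cover {i}"
    then have "cover (flip k {i, j}) = cover (flip j {i, j})"
      using assms by (auto simp: flip_def insert_commute insert_Diff_if)
    then show False using cover_inj[of "{i, j}" k j] assms by auto
  qed
qed

text \<open>If \<open>I\<close> lies in the fibre of the empty set, then \<open>card I = 1\<close> is excluded by the
  absence of loops, 2 by local injectivity, 3 by the absence of triangles, 4 by uniqueness of quadrangles, 5 by $a_2=0$ and 6 by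
  $c_3=3$.\<close>

lemma card_labels_folded:
  assumes uI: "cover I = u" and ne: "I \<noteq> {}"
  shows "card I \<ge> 7"
proof (rule ccontr)
  assume "\<not> card I \<ge> 7"
  moreover have "card I \<noteq> 0" using ne finite_I by simp
  ultimately have "card I \<in> {1, 2, 3, 4, 5, 6}" by auto
  moreover obtain xs where xs: "set xs = I" "distinct xs"
    using finite_distinct_list[OF finite_I] by blast
  then have "length xs = card I" using distinct_card by metis
  ultimately consider "length xs = 1" | "length xs = 2" | "length xs = 3" | "length xs = 4"
    | "length xs = 5" | "length xs = 6" by auto
  then show False
  proof cases
    case 1
    then obtain a where I: "I = {a}" using xs by (auto simp: length_Suc_conv)
    have "a \<in> I" using I by simp
    then have "u \<sim> cover {a}" using cover_adj_insert[of "{}" a] by simp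
    then show False using uI I adj_neq by metis
  next
    case 2
    then obtain a b where I: "I = {a, b}" "a \<noteq> b"
      using xs by (auto simp: length_Suc_conv numeral_eq_Suc)
    then show False using uI cover_pair(1)[of a b] by simp
  next
    case 3
    then obtain a b c where I: "I = {a, b, c}" "distinct [a, b, c]"
      using xs by (auto simp: length_Suc_conv numeral_eq_Suc)
    have mem: "a \<in> I" "b \<in> I" "c \<in> I" using I by auto
    have "cover {a, b, c} = u" using uI I by metis
    then have "u \<sim> cover {a}" "cover {a} \<sim> cover {a, b}" "cover {a, b} \<sim> u"
      using mem I(2) cover_adj_insert[of "{}" a] cover_adj_insert[of "{a}" b]
        cover_adj_insert[of "{a, b}" c]
      by (auto simp: insert_commute)
    then show False using not_triangle adj_sym by blast
  next
    case 4
    then obtain a b c d where I: "I = {a, b, c, d}" "distinct [a, b, c, d]"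
      using xs by (auto simp: length_Suc_conv numeral_eq_Suc)
    have mem: "a \<in> I" "b \<in> I" "c \<in> I" "d \<in> I" using I by auto
    have full: "cover {a, b, c, d} = u" using uI I by metis
    \<comment> \<open>The set \<open>{a, b, c}\<close> lacks only one label, so it lies over a
      neighbour of \<open>u\<close> and gives a third common neighbour of \<open>u\<close> and
      \<open>cover {a, b}\<close>.\<close>
    have fl: "flip a {a, b} = {b}" "flip b {a, b} = {a}" "flip c {a, b} = {a, b, c}"
      using I(2) by (auto simp: flip_def)
    have u_adj: "u \<sim> cover (flip a {a, b})" "u \<sim> cover (flip b {a, b})" "u \<sim> cover (flip c {a, b})"
      using mem I(2) full adj_sym[of "cover {a, b, c}" u] cover_adj_insert[of "{}"]
        cover_adj_insert[of "{a, b, c}" d]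
      by (auto simp: insert_commute fl)
    have "cover (flip b {a, b}) = cover (flip c {a, b})"
    proof (rule common_nbr_unique[of u "cover {a, b}" "cover (flip a {a, b})"])
      show "u \<noteq> cover {a, b}" using cover_pair(1)[of a b] mem I(2) by simp
    qed (use mem I(2) u_adj cover_adj[of "{a, b}"] cover_inj[of "{a, b}" a] in auto)
    then show False using cover_inj[of "{a, b}" b c] mem I(2) by simp
  next
    case 5
    then obtain a b c d e where I: "I = {a, b, c, d, e}" "distinct [a, b, c, d, e]"
      using xs by (auto simp: length_Suc_conv numeral_eq_Suc)
    have mem: "a \<in> I" "b \<in> I" "c \<in> I" "d \<in> I" "e \<in> I" using I by auto
    \<comment> \<open>The triple is the complement of a pair, so its image has distance 2 from
      \<open>u\<close>, and it is adjacent to the image of the pair \<open>{a, b}\<close>, also at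
      distance 2.\<close>
    have "I - {d, e} = {a, b, c}" using I by auto
    then have "u \<noteq> cover {a, b, c}" "\<exists>w. u \<sim> w \<and> w \<sim> cover {a, b, c}"
      using mem I(2) cover_not_pair[OF uI, of d e] by auto
    moreover have "u \<noteq> cover {a, b}" "\<exists>w. u \<sim> w \<and> w \<sim> cover {a, b}"
      using mem I(2) cover_pair[of a b] by auto
    moreover have "cover {a, b} \<sim> cover {a, b, c}"
      using cover_adj_insert[of "{a, b}" c] mem I(2) by (auto simp: insert_commute)
    ultimately show False using not_adj_dist2 by blast
  next
    case 6
    then obtain a b c d e f where I: "I = {a, b, c, d, e, f}" "distinct [a, b, c, d, e, f]"
      using xs by (auto simp: length_Suc_conv numeral_eq_Suc)
    have mem: "a \<in> I" "b \<in> I" "c \<in> I" "d \<in> I" "e \<in> I" "f \<in> I" using I by auto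
    let ?x = "cover {a, b, c}"
    let ?D = "{y. ?x \<sim> y \<and> u \<noteq> y \<and> (\<exists>w. u \<sim> w \<and> w \<sim> y)}"
    have card: "card ?D = 3"
      using cover_triple_dist3[of a b c] mem I(2) base_vertex by (intro dist3_nbrs_card) simp_all
    have "inj_on (\<lambda>i. cover (flip i {a, b, c})) {a, b, c, d}"
      using cover_inj[of "{a, b, c}"] mem by (auto simp: inj_on_def)
    then have card4: "card ((\<lambda>i. cover (flip i {a, b, c})) ` {a, b, c, d}) = 4"
      using I(2) by (simp add: card_image)
    \<comment> \<open>Four neighbours of \<open>?x\<close> at distance 2 from \<open>u\<close>:
      three come from pairs, the fourth from the complement of the pair
      \<open>{e, f}\<close>.\<close>
    have sub: "(\<lambda>i. cover (flip i {a, b, c})) ` {a, b, c, d} \<subseteq> ?D"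
    proof
      fix y assume "y \<in> (\<lambda>i. cover (flip i {a, b, c})) ` {a, b, c, d}"
      then obtain i where i: "i \<in> {a, b, c, d}" "y = cover (flip i {a, b, c})" by blast
      then have "i \<in> I" using mem by blast
      then have "?x \<sim> y" using cover_adj[of "{a, b, c}" i] mem i(2) by simp
      have "I - {e, f} = {a, b, c, d}" using I by auto
      then have "u \<noteq> cover {a, b, c, d} \<and> (\<exists>w. u \<sim> w \<and> w \<sim> cover {a, b, c, d})"
        using mem I(2) cover_not_pair[OF uI, of e f] by simp
      then have "\<forall>X\<in>{{b, c}, {a, c}, {a, b}, {a, b, c, d}}.
          u \<noteq> cover X \<and> (\<exists>w. u \<sim> w \<and> w \<sim> cover X)"
        using mem I(2) cover_pair[of b c] cover_pair[of a c] cover_pair[of a b] by simp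
      moreover have "flip i {a, b, c} \<in> {{b, c}, {a, c}, {a, b}, {a, b, c, d}}"
        using i(1) I(2) by (auto simp: flip_def)
      ultimately have "u \<noteq> y \<and> (\<exists>w. u \<sim> w \<and> w \<sim> y)"
        unfolding i(2) by (rule bspec)
      with \<open>?x \<sim> y\<close> show "y \<in> ?D" by simp
    qed
    have "finite ?D" by (rule card_ge_0_finite) (simp only: card zero_less_numeral)
    from card_mono[OF this sub] show False unfolding card card4 by simp
  qed
qed

text \<open>If \<open>S\<close> were a nonempty proper subset, an even permutation could exchange
  one of its labels for a missing one. The result again lies over \<open>u\<close> and is two steps
  from \<open>S\<close>, against local injectivity.\<close>

lemma fibre_base:
  assumes equiv: "\<And>\<sigma> S T. \<sigma> permutes I \<Longrightarrow> evenperm \<sigma> \<Longrightarrow> S \<subseteq> I \<Longrightarrow> T \<subseteq> I \<Longrightarrow>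
      cover S = cover T \<Longrightarrow> cover (\<sigma> ` S) = cover (\<sigma> ` T)"
    and S: "S \<subseteq> I" "cover S = u"
  shows "S = {} \<or> S = I"
proof (rule ccontr)
  assume "\<not> (S = {} \<or> S = I)"
  then obtain i j where ij: "i \<in> S" "j \<in> I - S" using S by blast
  show False
  proof (cases "I = {i, j}")
    \<comment> \<open>With two labels the alternating group is trivial and offers no exchange; but
      then \<open>S\<close> has one element and lies over a neighbour of \<open>u\<close>.\<close>
    case True
    then have "S = {i}" using S ij by blast
    then show False using S ij cover_adj_insert[of "{}" i] adj_neq by auto
  next
    case False
    then obtain k where "k \<in> I" "k \<noteq> i" "k \<noteq> j" using S ij by blast
    then obtain \<sigma> where \<sigma>: "\<sigma> permutes I" "evenperm \<sigma>" "\<sigma> ` S = flip i (flip j S)"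
      using ex_evenperm_exchange[OF ij] S by blast
    \<comment> \<open>The permutation fixes {}, so the exchanged set still lies over
      \<open>u\<close>; it and \<open>S\<close> are both neighbours of
      \<open>flip j S\<close>.\<close>
    have "cover (flip i (flip j S)) = cover (flip j (flip j S))"
      using equiv[OF \<sigma>(1,2) S(1), of "{}"] \<sigma>(3) S(2) by simp
    then have "i = j" using cover_inj[of "flip j S" i j] flip_subset[OF S(1), of j] S ij by blast
    then show False using ij by blast
  qed
qed

text \<open>The neighbours of \<open>u\<close> are labelled once by the frame over {} and once by
  the frame over \<open>I\<close>. Comparing the two gives a bijection of \<open>I\<close> that
  respects even permutations and hence is the identity, so the two frames agree, and with them all
  frames reached from them by the same crossings.\<close>

lemma cover_complement:
  assumes equiv: "\<And>\<sigma> S T. \<sigma> permutes I \<Longrightarrow> evenperm \<sigma> \<Longrightarrow> S \<subseteq> I \<Longrightarrow> T \<subseteq> I \<Longrightarrow>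
      cover S = cover T \<Longrightarrow> cover (\<sigma> ` S) = cover (\<sigma> ` T)"
    and uI: "cover I = u" and S: "S \<subseteq> I"
  shows "cover (I - S) = cover S"
proof -
  have label: "cover {i} = cover (flip i I)" if i: "i \<in> I" for i
  proof -
    have "cover I \<sim> cover {i}" using cover_adj_insert[of "{}" i] i uI by simp
    then obtain j where j: "j \<in> I" "cover {i} = cover (flip j I)"
      using cover_nbr[of I] by blast
    have "j = i"
    proof (rule ccontr)
      assume "j \<noteq> i"
      moreover have "7 \<le> card I" using card_labels_folded uI i by blast
      ultimately have "card (I - {i, j}) \<ge> 2" using i j finite_I by (simp add: card_Diff_subset)
      then obtain p q where pq: "p \<in> I - {i, j}" "q \<in> I - {i, j}" "p \<noteq> q"
        by (metis card_le_Suc0_iff_eq finite_Diff finite_I not_less_eq_eq numeral_2_eq_2)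
      \<comment> \<open>It fixes \<open>i\<close> and sends \<open>j\<close> to \<open>p\<close>, so
        \<open>cover {i}\<close> would be both \<open>cover (flip j I)\<close> and
        \<open>cover (flip p I)\<close>.\<close>
      let ?\<sigma> = "three_cycle j p q"
      have d: "distinct [j, p, q]" using pq by auto
      have \<sigma>: "?\<sigma> permutes I" "evenperm ?\<sigma>"
        using three_cycle_permutes[of j p q I] evenperm_three_cycle[OF d] pq j by auto
      have "cover (?\<sigma> ` {i}) = cover (?\<sigma> ` flip j I)"
        using equiv[OF \<sigma>, of "{i}" "flip j I"] i j flip_subset[OF subset_refl j(1)] by simp
      moreover have "?\<sigma> ` flip j I = flip (?\<sigma> j) (?\<sigma> ` I)"
        using flip_image[OF permutes_inj[OF \<sigma>(1)]] by metis
      moreover have "?\<sigma> j = p" "?\<sigma> i = i"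
        using three_cycle_apply[OF d] pq \<open>j \<noteq> i\<close> by auto
      moreover have "?\<sigma> ` I = I" using permutes_image[OF \<sigma>(1)] .
      ultimately have "cover (flip j I) = cover (flip p I)" using j by simp
      then show False using cover_inj[of I j p] pq j by blast
    qed
    then show ?thesis using j by simp
  qed
  have "lift I = lift {}"
  proof (rule frame_eqI)
    show "snd (lift I) \<in> extensional I" "snd (lift {}) \<in> extensional I"
      using frame_lift[of I] frame_lift[of "{}"] by (auto simp: frame_def)
    show "fst (lift I) = fst (lift {})" using uI cover_empty by (simp add: cover_def)
    show "snd (lift I) i = snd (lift {}) i" if "i \<in> I" for i
      using snd_lift[of _ i] label that by (simp add: flip_def)
  qed
  have "lift (I - S) = lift S"
    using finite_subset[OF S finite_I] S
  proof (induction S rule: finite_induct)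
    case (insert i S)
    then have "I - insert i S = flip i (I - S)" "insert i S = flip i S" by (auto simp: flip_def)
    moreover have "S \<subseteq> I" "i \<in> I" using insert.prems by auto
    ultimately show ?case using insert.IH lift_flip[of "I - S" i] lift_flip[of S i] by simp
  qed (simp add: \<open>lift I = lift {}\<close>)
  then show ?thesis by (simp add: cover_def)
qed

text \<open>Induction walks \<open>S\<close> back to {}: a step from \<open>S\<close> to a smaller
  set is matched by a step from \<open>T\<close>, the induction hypothesis compares the ends, and
  local injectivity shows that both steps use the same label.\<close>

lemma cover_eq_iff:
  assumes base: "\<And>S. S \<subseteq> I \<Longrightarrow> cover S = u \<longleftrightarrow> S = {} \<or> folded \<and> S = I"
    and compl: "\<And>S. folded \<Longrightarrow> S \<subseteq> I \<Longrightarrow> cover (I - S) = cover S"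
    and S: "S \<subseteq> I" and T: "T \<subseteq> I"
  shows "cover S = cover T \<longleftrightarrow> T = S \<or> folded \<and> T = I - S"
proof
  show "T = S \<or> folded \<and> T = I - S \<Longrightarrow> cover S = cover T"
    using compl S by auto
  show "cover S = cover T \<Longrightarrow> T = S \<or> folded \<and> T = I - S"
    using finite_subset[OF S finite_I] S T
  proof (induction S arbitrary: T rule: finite_induct)
    case empty
    then show ?case using base[of T] by simp
  next
    case (insert i S)
    have iS: "insert i S = flip i S" using insert.hyps by (simp add: flip_def)
    have S: "S \<subseteq> I" "i \<in> I" using insert.prems by auto
    have "cover T \<sim> cover S"
      using cover_adj[OF S] insert.prems(1) iS adj_sym by auto
    then obtain j where j: "j \<in> I" "cover S = cover (flip j T)"
      using cover_nbr insert.prems(3) by blast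
    then consider "flip j T = S" | "folded" "flip j T = I - S"
      using insert.IH[of "flip j T"] S flip_subset[OF insert.prems(3) j(1)] by blast
    then show ?case
    proof cases
      case 1
      then have "T = flip j S" by auto
      then have "i = j" using cover_inj[OF S j(1)] insert.prems(1) iS by simp
      then show ?thesis using \<open>T = flip j S\<close> iS by simp
    next
      case 2
      then have "T = I - flip j S" using flip_Compl[OF j(1)] flip_flip by metis
      moreover from this have "cover T = cover (flip j S)"
        using compl[OF 2(1) flip_subset[OF S(1) j(1)]] by simp
      then have "i = j" using cover_inj[OF S j(1)] insert.prems(1) iS by simp
      ultimately show ?thesis using iS 2(1) by simp
    qed
  qed
qed

lemma cube_model_cover:
  assumes equiv: "\<And>\<sigma> S T. \<sigma> permutes I \<Longrightarrow> evenperm \<sigma> \<Longrightarrow> S \<subseteq> I \<Longrightarrow> T \<subseteq> I \<Longrightarrow>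
      cover S = cover T \<Longrightarrow> cover (\<sigma> ` S) = cover (\<sigma> ` T)"
  shows "cube_model \<Gamma> I (cover I = u) cover"
proof -
  have "S = {} \<or> S = I" if "S \<subseteq> I" "cover S = u" for S
    by (rule fibre_base[OF _ that]) (fact equiv)
  then have "cover S = u \<longleftrightarrow> S = {} \<or> cover I = u \<and> S = I" if "S \<subseteq> I" for S
    using that cover_empty by metis
  moreover have "cover (I - S) = cover S" if "cover I = u" "S \<subseteq> I" for S
    by (rule cover_complement[OF _ that]) (fact equiv)
  ultimately have "cover S = cover T \<longleftrightarrow> T = S \<or> cover I = u \<and> T = I - S"
    if "S \<subseteq> I" "T \<subseteq> I" for S T
    using that by (rule cover_eq_iff)
  moreover have "cover S \<sim> cover T \<longleftrightarrow> (\<exists>i\<in>I. cover (flip i S) = cover T)" if "S \<subseteq> I" for S T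
    using cover_nbr[OF that] cover_adj[OF that] by metis
  ultimately show ?thesis using cover_surj by (simp add: cube_model_def)
qed

end

section \<open>Cubes and folded cubes as quotients of the power set\<close>

lemma cube_modelD:
  assumes "cube_model \<Gamma> I folded p"
  shows "p ` Pow I = pverts \<Gamma>"
    and "S \<subseteq> I \<Longrightarrow> T \<subseteq> I \<Longrightarrow> p S = p T \<longleftrightarrow> T = S \<or> folded \<and> T = I - S"
    and "S \<subseteq> I \<Longrightarrow> T \<subseteq> I \<Longrightarrow> (p S, p T) \<in> parcs \<Gamma> \<longleftrightarrow> (\<exists>i\<in>I. p (flip i S) = p T)"
  using assms by (auto simp: cube_model_def)

text \<open>The fibres depend only on \<open>I\<close> and \<open>folded\<close>, so sending
  \<open>p S\<close> to \<open>q S\<close> is well defined and injective. The third property is kept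
  because it later prescribes the automorphism belonging to a label permutation.\<close>

lemma cube_model_iso_map:
  assumes m: "cube_model \<Gamma> I folded p" and m': "cube_model \<Delta> I folded q"
  obtains f where "bij_betw f (pverts \<Gamma>) (pverts \<Delta>)"
    "\<And>x y. x \<in> pverts \<Gamma> \<Longrightarrow> y \<in> pverts \<Gamma> \<Longrightarrow> (f x, f y) \<in> parcs \<Delta> \<longleftrightarrow> (x, y) \<in> parcs \<Gamma>"
    "\<And>S. S \<subseteq> I \<Longrightarrow> f (p S) = q S"
proof
  note D = cube_modelD[OF m] and D' = cube_modelD[OF m']
  define f where "f v = q (inv_into (Pow I) p v)" for v
  have pq: "p S = p T \<longleftrightarrow> q S = q T" if "S \<subseteq> I" "T \<subseteq> I" for S T
    using D(2) D'(2) that by simp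
  have V: "p S \<in> p ` Pow I" if "S \<subseteq> I" for S using that by blast
  show f: "f (p S) = q S" if "S \<subseteq> I" for S
    using pq[OF _ that, of "inv_into (Pow I) p (p S)"] inv_into_into[OF V[OF that]]
      f_inv_into_f[OF V[OF that]]
    by (simp add: f_def)
  show "bij_betw f (pverts \<Gamma>) (pverts \<Delta>)"
    unfolding D(1)[symmetric] D'(1)[symmetric] bij_betw_def
    using f pq by (fastforce simp: inj_on_def image_image)
  show "(f x, f y) \<in> parcs \<Delta> \<longleftrightarrow> (x, y) \<in> parcs \<Gamma>" if "x \<in> pverts \<Gamma>" "y \<in> pverts \<Gamma>" for x y
  proof -
    obtain S T where ST: "S \<subseteq> I" "x = p S" "T \<subseteq> I" "y = p T"
      using \<open>x \<in> pverts \<Gamma>\<close> \<open>y \<in> pverts \<Gamma>\<close> unfolding D(1)[symmetric] by blast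
    have "(\<exists>i\<in>I. p (flip i S) = p T) \<longleftrightarrow> (\<exists>i\<in>I. q (flip i S) = q T)"
      using pq[OF flip_subset[OF ST(1)] ST(3)] by blast
    then show ?thesis using ST f D(3) D'(3) by simp
  qed
qed

lemma cube_model_digraph_iso:
  assumes "pair_graph \<Gamma>" "pair_graph \<Delta>" "cube_model \<Gamma> I folded p" "cube_model \<Delta> I folded q"
  shows "digraph_iso (with_proj \<Gamma>) (with_proj \<Delta>)"
  unfolding digraph_iso_iff[OF assms(1,2)]
  by (rule cube_model_iso_map[OF assms(3,4)]) blast

lemma cube_model_transport:
  assumes "pair_graph \<Gamma>" "pair_graph \<Delta>" "digraph_iso (with_proj \<Gamma>) (with_proj \<Delta>)"
    and m: "cube_model \<Delta> I folded q"
  shows "\<exists>p. cube_model \<Gamma> I folded p"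
proof -
  obtain f where bij: "bij_betw f (pverts \<Gamma>) (pverts \<Delta>)"
    and adj: "\<And>x y. x \<in> pverts \<Gamma> \<Longrightarrow> y \<in> pverts \<Gamma> \<Longrightarrow> (f x, f y) \<in> parcs \<Delta> \<longleftrightarrow> (x, y) \<in> parcs \<Gamma>"
    using assms(3) unfolding digraph_iso_iff[OF assms(1,2)] by blast
  define p where "p S = inv_into (pverts \<Gamma>) f (q S)" for S
  note D = cube_modelD[OF m]
  have q: "q S \<in> pverts \<Delta>" if "S \<subseteq> I" for S using D(1) that by blast
  have fp: "f (p S) = q S" "p S \<in> pverts \<Gamma>" if "S \<subseteq> I" for S
    using bij q[OF that] unfolding p_def bij_betw_def
    by (simp_all add: f_inv_into_f inv_into_into)
  have "p ` Pow I = inv_into (pverts \<Gamma>) f ` pverts \<Delta>"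
    unfolding D(1)[symmetric] p_def by (simp add: image_image)
  then have "p ` Pow I = pverts \<Gamma>"
    using bij_betw_inv_into[OF bij] by (simp add: bij_betw_def)
  moreover have pq: "p S = p T \<longleftrightarrow> q S = q T" if "S \<subseteq> I" "T \<subseteq> I" for S T
    using fp that p_def by metis
  moreover have "(p S, p T) \<in> parcs \<Gamma> \<longleftrightarrow> (\<exists>i\<in>I. p (flip i S) = p T)" if "S \<subseteq> I" "T \<subseteq> I" for S T
  proof -
    have "(p S, p T) \<in> parcs \<Gamma> \<longleftrightarrow> (q S, q T) \<in> parcs \<Delta>"
      using adj[of "p S" "p T"] fp that by simp
    also have "\<dots> \<longleftrightarrow> (\<exists>i\<in>I. p (flip i S) = p T)"
      using D(3) that pq[OF flip_subset[OF that(1)] that(2)] by blast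
    finally show ?thesis .
  qed
  ultimately have "cube_model \<Gamma> I folded p"
    using D(2) by (simp add: cube_model_def)
  then show ?thesis by blast
qed

section \<open>Label sets as binary vectors\<close>

definition bits :: "nat \<Rightarrow> nat set \<Rightarrow> nat \<Rightarrow> int" where
  "bits n S = (\<lambda>i\<in>{1..n}. if i \<in> S then 1 else 0)"

context
  notes One_nat_def [simp del]
begin

lemma bits_support: "S \<subseteq> {1..n} \<Longrightarrow> {i \<in> {1..n}. bits n S i = 1} = S"
  by (auto simp: bits_def split: if_splits)

lemma bits_eq_iff: "S \<subseteq> {1..n} \<Longrightarrow> T \<subseteq> {1..n} \<Longrightarrow> bits n S = bits n T \<longleftrightarrow> S = T"
  using bits_support by metis

lemma bits_image: "bits n ` Pow {1..n} = carrier (F2_vectors n)"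
proof
  show "bits n ` Pow {1..n} \<subseteq> carrier (F2_vectors n)"
    by (auto simp: carrier_F2_vectors bits_def split: if_splits)
  show "carrier (F2_vectors n) \<subseteq> bits n ` Pow {1..n}"
  proof
    fix x assume x: "x \<in> carrier (F2_vectors n)"
    then have "x = bits n {i \<in> {1..n}. x i = 1}"
      by (force simp: carrier_F2_vectors bits_def PiE_def Pi_def extensional_def fun_eq_iff)
    then show "x \<in> bits n ` Pow {1..n}" by blast
  qed
qed

lemma bits_adj_iff:
  assumes "S \<subseteq> {1..n}" "T \<subseteq> {1..n}"
  shows "(bits n S, bits n T) \<in> parcs (cube n) \<longleftrightarrow> (\<exists>i\<in>{1..n}. flip i S = T)"
proof -
  have "{i \<in> {1..n}. bits n S i \<noteq> bits n T i} = sym_diff S T"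
    using assms by (auto simp: bits_def split: if_splits)
  then have "(bits n S, bits n T) \<in> parcs (cube n) \<longleftrightarrow> card (sym_diff S T) = 1"
    using assms by (simp add: cube_def flip: bits_image)
  also have "\<dots> \<longleftrightarrow> (\<exists>i. sym_diff S T = {i})"
    by (simp add: card_1_singleton_iff One_nat_def)
  also have "\<dots> \<longleftrightarrow> (\<exists>i\<in>{1..n}. flip i S = T)"
  proof
    assume "\<exists>i. sym_diff S T = {i}"
    then obtain i where i: "sym_diff S T = {i}" by blast
    then have "i \<in> {1..n}" using assms by blast
    moreover have "x \<in> flip i S \<longleftrightarrow> x \<in> T" for x
    proof -
      have "x \<in> sym_diff S T \<longleftrightarrow> x = i" using i by simp
      then show ?thesis by (auto simp: flip_def)
    qed
    ultimately show "\<exists>i\<in>{1..n}. flip i S = T" by blast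
  qed (auto simp: flip_def split: if_splits)
  finally show ?thesis .
qed

lemma cube_model_cube: "cube_model (cube n) {1..n} False (bits n)"
proof -
  have "(bits n S, bits n T) \<in> parcs (cube n) \<longleftrightarrow> (\<exists>i\<in>{1..n}. bits n (flip i S) = bits n T)"
    if "S \<subseteq> {1..n}" "T \<subseteq> {1..n}" for S T
    using bits_adj_iff[OF that] bits_eq_iff[OF flip_subset[OF that(1)] that(2)] by blast
  moreover have "bits n ` Pow {1..n} = pverts (cube n)"
    by (simp add: bits_image cube_def)
  ultimately show ?thesis
    using bits_eq_iff by (auto simp: cube_model_def)
qed

lemma r_coset_bits:
  assumes "S \<subseteq> {1..n}"
  shows "repetition_code n #>\<^bsub>F2_vectors n\<^esub> bits n S = {bits n S, bits n ({1..n} - S)}"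
proof -
  have "x \<otimes>\<^bsub>F2_vectors n\<^esub> y = (\<lambda>i\<in>{1..n}. (x i + y i) mod 2)" for x y
    by (simp add: F2_vectors_def product_group_def)
  moreover from this have "(\<lambda>i\<in>{1..n}. 0) \<otimes>\<^bsub>F2_vectors n\<^esub> bits n S = bits n S"
    "(\<lambda>i\<in>{1..n}. 1) \<otimes>\<^bsub>F2_vectors n\<^esub> bits n S = bits n ({1..n} - S)"
    by (auto simp: bits_def fun_eq_iff)
  ultimately show ?thesis
    by (simp add: r_coset_def repetition_code_def insert_commute)
qed

text \<open>For \<open>n = 1\<close> the only unit step leads back to the same coset, so the model
  would ask for a loop, which the condition \<open>A \<noteq> B\<close> forbids.\<close>

lemma cube_model_folded_cube:
  assumes n: "n \<ge> 2"
  shows "cube_model (folded_cube n) {1..n} True (\<lambda>S. {bits n S, bits n ({1..n} - S)})"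
    (is "cube_model _ ?I True ?p")
proof -
  have V: "pverts (folded_cube n) = ?p ` Pow ?I"
  proof -
    have "pverts (folded_cube n)
        = (\<lambda>a. repetition_code n #>\<^bsub>F2_vectors n\<^esub> a) ` bits n ` Pow {1..n}"
      unfolding bits_image by (auto simp: folded_cube_def RCOSETS_def)
    then show ?thesis by (simp add: image_image r_coset_bits cong: image_cong_simp)
  qed
  have eq: "?p S = ?p T \<longleftrightarrow> T = S \<or> True \<and> T = ?I - S" if "S \<subseteq> ?I" "T \<subseteq> ?I" for S T
    using that by (simp add: doubleton_eq_iff bits_eq_iff) blast
  have adj: "(?p S, ?p T) \<in> parcs (folded_cube n) \<longleftrightarrow> (\<exists>i\<in>?I. ?p (flip i S) = ?p T)"
    if ST: "S \<subseteq> ?I" "T \<subseteq> ?I" for S T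
  proof -
    have V': "?p S \<in> pverts (folded_cube n)" "?p T \<in> pverts (folded_cube n)"
      using V ST by auto
    have co: "(bits n X, bits n Y) \<in> parcs (cube n) \<longleftrightarrow> (\<exists>i\<in>?I. flip i X = Y)"
      if "X \<in> {S, ?I - S}" "Y \<in> {T, ?I - T}" for X Y
      using that ST by (intro bits_adj_iff) auto
    have fl: "flip i (?I - S) = ?I - flip i S" if "i \<in> ?I" for i
      using flip_Compl that by metis
    have c: "?I - flip i S = T \<longleftrightarrow> flip i S = ?I - T" "?I - flip i S = ?I - T \<longleftrightarrow> flip i S = T"
      if "i \<in> ?I" for i
      using flip_subset[OF ST(1) that] ST(2) by blast+
    have "(\<exists>x\<in>?p S. \<exists>y\<in>?p T. (x, y) \<in> parcs (cube n))
        \<longleftrightarrow> (\<exists>i\<in>?I. flip i S = T \<or> flip i S = ?I - T)"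
      using fl c by (simp add: co) metis
    also have "\<dots> \<longleftrightarrow> (\<exists>i\<in>?I. ?p (flip i S) = ?p T)"
      using eq[OF flip_subset[OF ST(1)] ST(2)] ST(2) c by blast
    finally have *: "(\<exists>x\<in>?p S. \<exists>y\<in>?p T. (x, y) \<in> parcs (cube n))
        \<longleftrightarrow> (\<exists>i\<in>?I. ?p (flip i S) = ?p T)" .
    have "?p S \<noteq> ?p (flip i S)" if i: "i \<in> ?I" for i
    proof -
      \<comment> \<open>A coordinate other than \<open>i\<close>, on which \<open>flip i S\<close>
        agrees with \<open>S\<close> and therefore differs from the complement.\<close>
      define j where "j = (if i = 1 then 2 else 1 :: nat)"
      have j: "j \<in> ?I" "j \<noteq> i" using n by (auto simp: j_def)
      have "flip i S \<noteq> S" by (auto simp: flip_def)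
      moreover have "j \<in> flip i S \<longleftrightarrow> j \<in> S" using j(2) by (auto simp: flip_def)
      then have "flip i S \<noteq> ?I - S" using j(1) by blast
      ultimately show ?thesis using eq[OF ST(1) flip_subset[OF ST(1) i]] by blast
    qed
    then have "?p S \<noteq> ?p T" if "\<exists>i\<in>?I. ?p (flip i S) = ?p T"
      using that by metis
    then show ?thesis
      using V' unfolding *[symmetric] by (auto simp: folded_cube_def)
  qed
  show ?thesis
    unfolding cube_model_def using V eq adj by simp
qed

end

section \<open>The action of a vertex stabiliser on the neighbours\<close>

lemma vertex_stabilizer_iff:
  "g \<in> carrier (vertex_stabilizer \<Gamma> u) \<longleftrightarrow>
    g \<in> extensional (pverts \<Gamma>) \<and> bij_betw g (pverts \<Gamma>) (pverts \<Gamma>) \<and>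
    (\<forall>x\<in>pverts \<Gamma>. \<forall>y\<in>pverts \<Gamma>. (g x, g y) \<in> parcs \<Gamma> \<longleftrightarrow> (x, y) \<in> parcs \<Gamma>) \<and> g u = u"
  by (auto simp: vertex_stabilizer_def stabilizer_def aut_group_def Bij_def)

lemma vertex_stabilizer_mult:
  assumes "g \<in> carrier (vertex_stabilizer \<Gamma> u)" "h \<in> carrier (vertex_stabilizer \<Gamma> u)"
    "x \<in> pverts \<Gamma>"
  shows "(g \<otimes>\<^bsub>vertex_stabilizer \<Gamma> u\<^esub> h) x = g (h x)"
  using assms
  by (auto simp: vertex_stabilizer_def stabilizer_def aut_group_def BijGroup_def compose_eq)

context framed_rectagraph
begin

lemma label_nbr: "i \<in> I \<Longrightarrow> l i \<in> nbhd \<Gamma> u"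
  using base_labels by (auto simp: bij_betw_def)

lemma label_inj: "i \<in> I \<Longrightarrow> j \<in> I \<Longrightarrow> l i = l j \<longleftrightarrow> i = j"
  using base_labels by (auto simp: bij_betw_def dest: inj_onD)

lemma stabilizer_cover:
  assumes g: "g \<in> carrier (vertex_stabilizer \<Gamma> u)"
    and "\<sigma> permutes I" "\<And>i. i \<in> I \<Longrightarrow> g (l i) = l (\<sigma> i)" "S \<subseteq> I"
  shows "cover (\<sigma> ` S) = g (cover S)"
  using lift_equivariant[of g \<sigma> S] assms(2-) g[unfolded vertex_stabilizer_iff] by blast

lemma ex_label_permutation:
  assumes g: "g \<in> carrier (vertex_stabilizer \<Gamma> u)"
  shows "\<exists>\<sigma>. \<sigma> permutes I \<and> (\<forall>i\<in>I. g (l i) = l (\<sigma> i))"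
proof -
  let ?N = "nbhd \<Gamma> u"
  interpret A: group_action "vertex_stabilizer \<Gamma> u" ?N "natural_action ?N"
    using base_vertex by (rule group_action_vertex_stabilizer)
  have "bij_betw (natural_action ?N g) ?N ?N"
    using A.inj_prop[OF g] A.surj_prop[OF g] by (simp add: bij_betw_def)
  then have gN: "bij_betw g ?N ?N"
    by (simp add: natural_action_def cong: bij_betw_cong)
  define \<sigma> where "\<sigma> i = (if i \<in> I then inv_into I l (g (l i)) else i)" for i
  have "bij_betw (inv_into I l \<circ> (g \<circ> l)) I I"
    using base_labels gN by (meson bij_betw_inv_into bij_betw_trans)
  then have "bij_betw \<sigma> I I"
    by (simp add: \<sigma>_def cong: bij_betw_cong)
  then have "\<sigma> permutes I"
    by (rule bij_imp_permutes) (simp add: \<sigma>_def)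
  moreover have "g (l i) = l (\<sigma> i)" if "i \<in> I" for i
    using that gN base_labels label_nbr[OF that]
    by (simp add: \<sigma>_def bij_betw_def) (metis f_inv_into_f imageI)
  ultimately show ?thesis by blast
qed

lemma stabilizer_eqI:
  assumes g: "g \<in> carrier (vertex_stabilizer \<Gamma> u)" and h: "h \<in> carrier (vertex_stabilizer \<Gamma> u)"
    and \<sigma>: "\<sigma> permutes I" and gl: "\<And>i. i \<in> I \<Longrightarrow> g (l i) = l (\<sigma> i)"
    and hl: "\<And>i. i \<in> I \<Longrightarrow> h (l i) = l (\<sigma> i)"
  shows "g = h"
proof (rule extensionalityI)
  show "g \<in> extensional (pverts \<Gamma>)" "h \<in> extensional (pverts \<Gamma>)"
    using g h by (auto simp: vertex_stabilizer_iff)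
  fix v assume "v \<in> pverts \<Gamma>"
  then obtain S where "S \<subseteq> I" "v = cover S" using cover_surj by blast
  then show "g v = h v"
    using stabilizer_cover[OF g \<sigma> gl] stabilizer_cover[OF h \<sigma> hl] by metis
qed

end

text \<open>Sending an automorphism to its label permutation is a homomorphism because that
  permutation is unique. It is injective by \<open>stabilizer_eqI\<close>, and surjective by the
  assumption that all permutations occur.\<close>

lemma perm_isomorphic_sym_group:
  assumes "framed_rectagraph \<Gamma> {1..n} u l"
    and real: "\<And>\<sigma>. \<sigma> permutes {1..n} \<Longrightarrow>
      \<exists>g\<in>carrier (vertex_stabilizer \<Gamma> u). \<forall>i\<in>{1..n}. g (l i) = l (\<sigma> i)"
  shows "perm_isomorphic (vertex_stabilizer \<Gamma> u) (nbhd \<Gamma> u) (natural_action (nbhd \<Gamma> u))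
    (sym_group n) {1..n} (natural_action {1..n})"
proof -
  let ?I = "{1..n}" and ?G = "vertex_stabilizer \<Gamma> u" and ?N = "nbhd \<Gamma> u"
  interpret framed_rectagraph \<Gamma> ?I u l by fact
  interpret G: group ?G using base_vertex by (rule group_vertex_stabilizer)
  obtain \<psi> where \<psi>: "\<And>g. g \<in> carrier ?G \<Longrightarrow> \<psi> g permutes ?I"
    "\<And>g i. g \<in> carrier ?G \<Longrightarrow> i \<in> ?I \<Longrightarrow> g (l i) = l (\<psi> g i)"
    using ex_label_permutation by metis
  have \<psi>_eqI: "\<psi> g = \<sigma>" if "g \<in> carrier ?G" "\<sigma> permutes ?I" "\<forall>i\<in>?I. g (l i) = l (\<sigma> i)" for g \<sigma>
  proof
    fix i show "\<psi> g i = \<sigma> i"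
    proof (cases "i \<in> ?I")
      case True
      then have "l (\<psi> g i) = l (\<sigma> i)" using \<psi>(2) that by metis
      then show ?thesis
        using label_inj permutes_in_image[OF \<psi>(1)] permutes_in_image[OF that(2)] that(1) True by blast
    next
      case False
      then show ?thesis
        using permutes_not_in[OF \<psi>(1)[OF that(1)]] permutes_not_in[OF that(2)] by simp
    qed
  qed
  have "\<psi> \<in> hom ?G (sym_group n)"
  proof (rule homI)
    fix g assume "g \<in> carrier ?G"
    then show "\<psi> g \<in> carrier (sym_group n)" using \<psi>(1) by (simp add: sym_group_carrier)
  next
    fix g h assume gh: "g \<in> carrier ?G" "h \<in> carrier ?G"
    have "\<psi> (g \<otimes>\<^bsub>?G\<^esub> h) = \<psi> g \<circ> \<psi> h"
    proof (rule \<psi>_eqI)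
      show "g \<otimes>\<^bsub>?G\<^esub> h \<in> carrier ?G" using gh by simp
      show "\<psi> g \<circ> \<psi> h permutes ?I" using \<psi>(1) gh by (intro permutes_compose)
      show "\<forall>i\<in>?I. (g \<otimes>\<^bsub>?G\<^esub> h) (l i) = l ((\<psi> g \<circ> \<psi> h) i)"
      proof
        fix i assume i: "i \<in> ?I"
        have "l i \<in> pverts \<Gamma>" using label_nbr[OF i] by (simp add: nbhd_def)
        then have "(g \<otimes>\<^bsub>?G\<^esub> h) (l i) = g (h (l i))" using gh vertex_stabilizer_mult by metis
        also have "\<dots> = g (l (\<psi> h i))" using \<psi>(2)[OF gh(2) i] by simp
        also have "\<dots> = l (\<psi> g (\<psi> h i))"
          using i permutes_in_image[OF \<psi>(1)[OF gh(2)]] by (intro \<psi>(2)[OF gh(1)]) blast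
        finally show "(g \<otimes>\<^bsub>?G\<^esub> h) (l i) = l ((\<psi> g \<circ> \<psi> h) i)" by simp
      qed
    qed
    then show "\<psi> (g \<otimes>\<^bsub>?G\<^esub> h) = \<psi> g \<otimes>\<^bsub>sym_group n\<^esub> \<psi> h"
      by (simp add: sym_group_mult)
  qed
  moreover have "bij_betw \<psi> (carrier ?G) (carrier (sym_group n))"
    unfolding bij_betw_def
  proof
    show "inj_on \<psi> (carrier ?G)"
    proof (rule inj_onI)
      fix g h assume gh: "g \<in> carrier ?G" "h \<in> carrier ?G" "\<psi> g = \<psi> h"
      show "g = h"
        using stabilizer_eqI[OF gh(1,2) \<psi>(1)[OF gh(1)]] \<psi>(2) gh by metis
    qed
    show "\<psi> ` carrier ?G = carrier (sym_group n)"
    proof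
      show "\<psi> ` carrier ?G \<subseteq> carrier (sym_group n)"
        using \<psi>(1) by (auto simp: sym_group_carrier)
      show "carrier (sym_group n) \<subseteq> \<psi> ` carrier ?G"
      proof
        fix \<sigma> assume "\<sigma> \<in> carrier (sym_group n)"
        then have \<sigma>: "\<sigma> permutes ?I" by (simp add: sym_group_carrier)
        then obtain g where "g \<in> carrier ?G" "\<forall>i\<in>?I. g (l i) = l (\<sigma> i)" using real by blast
        then show "\<sigma> \<in> \<psi> ` carrier ?G" using \<psi>_eqI \<sigma> by (metis imageI)
      qed
    qed
  qed
  ultimately have iso: "\<psi> \<in> iso ?G (sym_group n)" by (simp add: iso_def)
  let ?\<phi> = "inv_into ?I l"
  have "bij_betw ?\<phi> ?N ?I" using base_labels by (rule bij_betw_inv_into)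
  moreover have "?\<phi> (natural_action ?N g x) = natural_action ?I (\<psi> g) (?\<phi> x)"
    if g: "g \<in> carrier ?G" and x: "x \<in> ?N" for g x
  proof -
    have inv: "?\<phi> (l i) = i" if "i \<in> ?I" for i
      using base_labels that by (simp add: bij_betw_def)
    obtain i where i: "i \<in> ?I" "x = l i" using x base_labels unfolding bij_betw_def by blast
    have "?\<phi> (natural_action ?N g x) = ?\<phi> (g (l i))" using x i by (simp add: natural_action_def)
    also have "\<dots> = \<psi> g i"
      using \<psi>(2)[OF g i(1)] inv permutes_in_image[OF \<psi>(1)[OF g]] i(1) by metis
    finally show ?thesis using i inv by (simp add: natural_action_def)
  qed
  ultimately show ?thesis
    unfolding perm_isomorphic_def
    using iso faithful_action_sym_group[of n] group_action_vertex_stabilizer[OF base_vertex]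
    by (auto simp: faithful_action_def)
qed

text \<open>Relabelling commutes with complementation and carries the step \<open>i\<close> to the
  step \<open>\<sigma> i\<close>.\<close>

lemma cube_model_permute:
  assumes m: "cube_model \<Gamma> I folded p" and \<sigma>: "\<sigma> permutes I"
  shows "cube_model \<Gamma> I folded (\<lambda>S. p (\<sigma> ` S))"
proof -
  note D = cube_modelD[OF m]
  have inj: "inj \<sigma>" and im: "\<sigma> ` I = I" using \<sigma> by (auto dest: permutes_inj permutes_image)
  have sub: "\<sigma> ` S \<subseteq> I" if "S \<subseteq> I" for S using image_mono[OF that, of \<sigma>] im by simp
  have "(\<lambda>S. p (\<sigma> ` S)) ` Pow I = p ` (image \<sigma> ` Pow I)" by (simp add: image_image)
  also have "image \<sigma> ` Pow I = Pow I" using image_Pow_surj[OF im] .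
  finally have "(\<lambda>S. p (\<sigma> ` S)) ` Pow I = pverts \<Gamma>" using D(1) by simp
  moreover have "p (\<sigma> ` S) = p (\<sigma> ` T) \<longleftrightarrow> T = S \<or> folded \<and> T = I - S"
    if "S \<subseteq> I" "T \<subseteq> I" for S T
  proof -
    have "\<sigma> ` (I - S) = I - \<sigma> ` S" using image_set_diff[OF inj] im by metis
    then show ?thesis
      using D(2)[OF sub[OF that(1)] sub[OF that(2)]] inj_image_eq_iff[OF inj] by metis
  qed
  moreover have "(p (\<sigma> ` S), p (\<sigma> ` T)) \<in> parcs \<Gamma> \<longleftrightarrow> (\<exists>i\<in>I. p (\<sigma> ` flip i S) = p (\<sigma> ` T))"
    if "S \<subseteq> I" "T \<subseteq> I" for S T
  proof -
    have "(p (\<sigma> ` S), p (\<sigma> ` T)) \<in> parcs \<Gamma> \<longleftrightarrow> (\<exists>i\<in>\<sigma> ` I. p (flip i (\<sigma> ` S)) = p (\<sigma> ` T))"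
      using D(3)[OF sub[OF that(1)] sub[OF that(2)]] im by simp
    then show ?thesis by (simp add: flip_image[OF inj])
  qed
  ultimately show ?thesis by (simp add: cube_model_def)
qed

lemma cube_model_imp_perm_isomorphic:
  assumes \<Gamma>: "cubical_rectagraph \<Gamma>" and m: "cube_model \<Gamma> {1..n} folded p"
    and n: "folded \<Longrightarrow> n \<ge> 3"
  shows "\<exists>u\<in>pverts \<Gamma>. perm_isomorphic (vertex_stabilizer \<Gamma> u) (nbhd \<Gamma> u)
    (natural_action (nbhd \<Gamma> u)) (sym_group n) {1..n} (natural_action {1..n})"
proof
  let ?I = "{1..n}"
  interpret cubical_rectagraph \<Gamma> by fact
  note D = cube_modelD[OF m]
  have u: "p {} \<in> pverts \<Gamma>" using D(1) by blast
  have "inj_on (\<lambda>i. p {i}) ?I"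
  proof (rule inj_onI)
    fix i j assume ij: "i \<in> ?I" "j \<in> ?I" "p {i} = p {j}"
    then have "{j} = {i} \<or> folded \<and> {j} = ?I - {i}" using D(2)[of "{i}" "{j}"] by simp
    \<comment> \<open>With \<open>n = 2\<close> the sets \<open>{1}\<close> and \<open>{2}\<close>
      would be complementary and their images would coincide, so the labelling of the neighbours
      would fail to be injective.\<close>
    moreover have "{j} \<noteq> ?I - {i}" if folded
    proof
      assume "{j} = ?I - {i}"
      then have "card {j} = card ?I - 1" using ij(1) by (metis card_Diff_singleton)
      then show False using n[OF that] by simp
    qed
    ultimately show "i = j" by auto
  qed
  moreover have "(\<lambda>i. p {i}) ` ?I = nbhd \<Gamma> (p {})"
  proof -
    have adj: "p {} \<sim> p T \<longleftrightarrow> (\<exists>i\<in>?I. p {i} = p T)" if "T \<subseteq> ?I" for T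
      using D(3)[of "{}" T] that by (simp add: flip_def)
    show ?thesis
    proof (intro equalityI subsetI)
      fix y assume "y \<in> (\<lambda>i. p {i}) ` ?I"
      then obtain i where "i \<in> ?I" "y = p {i}" by (rule imageE)
      then show "y \<in> nbhd \<Gamma> (p {})" using adj[of "{i}"] by (auto simp: nbhd_iff)
    next
      fix y assume y: "y \<in> nbhd \<Gamma> (p {})"
      then obtain T where T: "T \<subseteq> ?I" "y = p T" unfolding nbhd_def D(1)[symmetric] by blast
      then obtain i where "i \<in> ?I" "p {i} = y" using adj[OF T(1)] y by (auto simp: nbhd_iff)
      then show "y \<in> (\<lambda>i. p {i}) ` ?I" by (metis imageI)
    qed
  qed
  ultimately have F: "framed_rectagraph \<Gamma> ?I (p {}) (\<lambda>i. p {i})"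
    using u by unfold_locales (simp_all add: bij_betw_def)
  show "perm_isomorphic (vertex_stabilizer \<Gamma> (p {})) (nbhd \<Gamma> (p {}))
    (natural_action (nbhd \<Gamma> (p {}))) (sym_group n) ?I (natural_action ?I)"
  proof (rule perm_isomorphic_sym_group[OF F])
    fix \<sigma> assume \<sigma>: "\<sigma> permutes ?I"
    \<comment> \<open>The automorphism inducing \<open>\<sigma>\<close> is the isomorphism between
      two models of the same graph, \<open>p\<close> and its relabelling.\<close>
    obtain f where f: "bij_betw f (pverts \<Gamma>) (pverts \<Gamma>)"
      "\<And>x y. x \<in> pverts \<Gamma> \<Longrightarrow> y \<in> pverts \<Gamma> \<Longrightarrow> (f x, f y) \<in> parcs \<Gamma> \<longleftrightarrow> (x, y) \<in> parcs \<Gamma>"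
      "\<And>S. S \<subseteq> ?I \<Longrightarrow> f (p S) = p (\<sigma> ` S)"
      using cube_model_iso_map[OF m cube_model_permute[OF m \<sigma>]] by blast
    have "restrict f (pverts \<Gamma>) \<in> carrier (vertex_stabilizer \<Gamma> (p {}))"
      using f u by (simp add: vertex_stabilizer_iff f(3)[of "{}"] cong: bij_betw_cong)
    moreover have "restrict f (pverts \<Gamma>) (p {i}) = p {\<sigma> i}" if "i \<in> ?I" for i
    proof -
      have "p {i} \<in> pverts \<Gamma>" unfolding D(1)[symmetric] using that by (intro imageI) simp
      then show ?thesis using f(3)[of "{i}"] that by simp
    qed
    ultimately show "\<exists>g\<in>carrier (vertex_stabilizer \<Gamma> (p {})). \<forall>i\<in>?I. g (p {i}) = p {\<sigma> i}"
      by blast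
  qed
qed (use cube_modelD(1)[OF m] in blast)

text \<open>Asking only that \<open>H\<close> contain the even permutations treats the symmetric and
  the alternating group at once.\<close>

lemma perm_isomorphic_imp_cube_model:
  fixes n :: nat
  assumes \<Gamma>: "cubical_rectagraph \<Gamma>" and u: "u \<in> pverts \<Gamma>" and n: "n \<ge> 1"
    and H: "\<And>\<sigma>. \<sigma> permutes {1..n} \<Longrightarrow> evenperm \<sigma> \<Longrightarrow> \<sigma> \<in> carrier H"
    and pi: "perm_isomorphic (vertex_stabilizer \<Gamma> u) (nbhd \<Gamma> u) (natural_action (nbhd \<Gamma> u))
      H {1..n} (natural_action {1..n})"
  shows "\<exists>folded p. cube_model \<Gamma> {1..n} folded p \<and> (folded \<longrightarrow> n \<ge> 7)"
proof -
  let ?I = "{1..n}" and ?G = "vertex_stabilizer \<Gamma> u" and ?N = "nbhd \<Gamma> u"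
  interpret cubical_rectagraph \<Gamma> by fact
  obtain \<psi> \<phi> where \<psi>: "\<psi> \<in> iso ?G H" and \<phi>: "bij_betw \<phi> ?N ?I"
    and eq: "\<And>g x. g \<in> carrier ?G \<Longrightarrow> x \<in> ?N \<Longrightarrow>
      \<phi> (natural_action ?N g x) = natural_action ?I (\<psi> g) (\<phi> x)"
    using pi unfolding perm_isomorphic_def by blast
  \<comment> \<open>The labels are read off from the permutation isomorphism, so that
    \<open>\<psi> g\<close> is the label permutation of \<open>g\<close>.\<close>
  define l where "l = inv_into ?N \<phi>"
  have l: "bij_betw l ?I ?N" unfolding l_def using \<phi> by (rule bij_betw_inv_into)
  interpret framed_rectagraph \<Gamma> ?I u l
    using u l by unfold_locales simp_all
  have \<phi>l: "\<phi> (l i) = i" if "i \<in> ?I" for i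
    using \<phi> that by (simp add: l_def bij_betw_def f_inv_into_f)
  have l\<phi>: "l (\<phi> x) = x" if "x \<in> ?N" for x
    using \<phi> that by (simp add: l_def bij_betw_def)
  interpret A: group_action ?G ?N "natural_action ?N"
    using u by (rule group_action_vertex_stabilizer)
  have realized: "\<exists>g\<in>carrier ?G. \<forall>i\<in>?I. g (l i) = l (\<sigma> i)"
    if \<sigma>: "\<sigma> permutes ?I" "evenperm \<sigma>" for \<sigma>
  proof -
    have "\<sigma> \<in> \<psi> ` carrier ?G"
      using \<psi> H[OF \<sigma>] by (auto simp: iso_def bij_betw_def)
    then obtain g where g: "g \<in> carrier ?G" "\<psi> g = \<sigma>" by blast
    have "g (l i) = l (\<sigma> i)" if i: "i \<in> ?I" for i
    proof -
      have "\<phi> (natural_action ?N g (l i)) = \<sigma> i"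
        using eq[OF g(1) label_nbr[OF i]] i \<phi>l g(2) by (simp add: natural_action_def)
      moreover have "natural_action ?N g (l i) \<in> ?N"
        using A.surj_prop[OF g(1)] label_nbr[OF i] by blast
      ultimately have "natural_action ?N g (l i) = l (\<sigma> i)" using l\<phi> by metis
      then show ?thesis using label_nbr[OF i] by (simp add: natural_action_def)
    qed
    then show ?thesis using g(1) by blast
  qed
  have "cover (\<sigma> ` S) = cover (\<sigma> ` T)"
    if "\<sigma> permutes ?I" "evenperm \<sigma>" "S \<subseteq> ?I" "T \<subseteq> ?I" "cover S = cover T" for \<sigma> S T
    using realized[OF that(1,2)] stabilizer_cover[OF _ that(1)] that(3-5) by metis
  then have "cube_model \<Gamma> ?I (cover ?I = u) cover" by (rule cube_model_cover)
  \<comment> \<open>Here \<open>n \<ge> 1\<close> excludes the empty label set, for which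
    \<open>cover I = u\<close> holds trivially.\<close>
  moreover have "n \<ge> 7" if "cover ?I = u"
    using card_labels_folded[OF that] n by simp
  ultimately show ?thesis by blast
qed

theorem corollary1p4:
  fixes \<Gamma> :: "'a pair_pre_digraph" and n :: nat
  assumes "rectagraph \<Gamma>" and "a_const \<Gamma> 2 0" and "c_const \<Gamma> 3 3" and "n \<ge> 1"
  shows
    "(\<exists>u\<in>pverts \<Gamma>.
        perm_isomorphic (vertex_stabilizer \<Gamma> u) (nbhd \<Gamma> u) (natural_action (nbhd \<Gamma> u))
          (sym_group n) {1..n} (natural_action {1..n}) \<or>
        perm_isomorphic (vertex_stabilizer \<Gamma> u) (nbhd \<Gamma> u) (natural_action (nbhd \<Gamma> u))
          (alt_group n) {1..n} (natural_action {1..n}))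
     \<longleftrightarrow> digraph_iso (with_proj \<Gamma>) (with_proj (cube n)) \<or>
        (n \<ge> 7 \<and> digraph_iso (with_proj \<Gamma>) (with_proj (folded_cube n)))"
    (is "?L \<longleftrightarrow> ?R")
proof -
  have \<Gamma>: "cubical_rectagraph \<Gamma>"
    using assms by (simp add: cubical_rectagraph_def cubical_rectagraph_axioms_def)
  have pg: "pair_graph \<Gamma>" using assms(1) by (simp add: rectagraph_def)
  show ?thesis
  proof
    assume ?L
    then obtain u H where "u \<in> pverts \<Gamma>"
      and H: "H = sym_group n \<or> H = alt_group n"
      and "perm_isomorphic (vertex_stabilizer \<Gamma> u) (nbhd \<Gamma> u) (natural_action (nbhd \<Gamma> u))
        H {1..n} (natural_action {1..n})"
      by blast
    moreover have "\<sigma> \<in> carrier H" if "\<sigma> permutes {1..n}" "evenperm \<sigma>" for \<sigma>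
      using H that by (auto simp: sym_group_carrier alt_group_carrier)
    ultimately obtain folded p where m: "cube_model \<Gamma> {1..n} folded p" and n: "folded \<longrightarrow> n \<ge> 7"
      using perm_isomorphic_imp_cube_model[OF \<Gamma> _ assms(4)] by blast
    show ?R
    proof (cases folded)
      case True
      then have "digraph_iso (with_proj \<Gamma>) (with_proj (folded_cube n))"
        using m n cube_model_digraph_iso[OF pg pair_graph_folded_cube _ cube_model_folded_cube] by simp
      then show ?thesis using True n by blast
    next
      case False
      then show ?thesis
        using m cube_model_digraph_iso[OF pg pair_graph_cube _ cube_model_cube] by simp
    qed
  next
    assume ?R
    then obtain folded p where "cube_model \<Gamma> {1..n} folded p" "folded \<Longrightarrow> n \<ge> 3"
    proof (elim disjE conjE)
      assume "digraph_iso (with_proj \<Gamma>) (with_proj (cube n))"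
      then show thesis
        using cube_model_transport[OF pg pair_graph_cube _ cube_model_cube] that by blast
    next
      assume "n \<ge> 7" "digraph_iso (with_proj \<Gamma>) (with_proj (folded_cube n))"
      then show thesis
        using cube_model_transport[OF pg pair_graph_folded_cube _ cube_model_folded_cube] that[of True]
        by fastforce
    qed
    then show ?L using cube_model_imp_perm_isomorphic[OF \<Gamma>] by blast
  qed
qed

end
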